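(* For all real $z>0$, $d>0$ and $\nu\ge0$, $$I_2(z,d,\nu)=\int_0^d y^{\nu}e^{-y}e^{-zy^{-1/2}}\,dy=\frac{d^{1+\nu}}{\pi^{1/2}}\sum_{r=0}^\infty\frac{(-d)^r}{r!}\,G^{3,0}_{1,3}\left(\frac{z^2}{4d}\,\Big|\,{}^{\nu+r+2}_{\nu+r+1,\,0,\,\frac12}\right).$$
   Context: $I_2(z,d,\nu)$ denotes the integral $\int_0^d y^\nu e^{-y}e^{-zy^{-1/2}}\,dy$. Meijer $G$-function: for integers $0\le n\le p$, $0\le m\le q$, complex numbers $a_1,\dots,a_p$, $b_1,\dots,b_q$ such that no pole of $\Gamma(b_j+s)$ $(j=1,\dots,m)$ coincides with a pole of $\Gamma(1-a_j-s)$ $(j=1,\dots,n)$, and $z\ne 0$, $$G^{m,n}_{p,q}\left(z\,\Big|\,{}^{a_1,\ldots,a_p}_{b_1,\ldots,b_q}\right)=\frac{1}{2\pi i}\int_L\frac{\prod_{j=1}^m\Gamma(b_j+s)\prod_{j=1}^n\Gamma(1-a_j-s)}{\prod_{j=m+1}^q\Gamma(1-b_j-s)\prod_{j=n+1}^p\Gamma(a_j+s)}\,z^{-s}\,ds,$$ where empty products equal $1$, and $L$ is a loop beginning and ending at $-\infty$ and encircling all poles of $\Gamma(b_j+s)$, $j=1,\dots,m$, once in the positive direction, but none of the poles of $\Gamma(1-a_j-s)$, $j=1,\dots,n$. The integral is well-defined for all $z\neq0$ when $q\ge1$ and $p<q$, and it then equals the sum of the residues of the integrand at the poles of $\Gamma(b_j+s)$,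 $j=1,\dots,m$. In particular $$G^{3,0}_{1,3}\left(x\,\Big|\,{}^{a_1}_{b_1,b_2,b_3}\right)=\frac1{2\pi i}\int_L\frac{\Gamma(b_1+s)\Gamma(b_2+s)\Gamma(b_3+s)}{\Gamma(a_1+s)}\,x^{-s}\,ds.$$ For $x>0$, $x^{-s}=e^{-s\log x}$ with real logarithm. *)

theory Defs
  imports "HOL-Complex_Analysis.Complex_Analysis"
begin

definition I2 :: "real \<Rightarrow> real \<Rightarrow> real \<Rightarrow> real" where
  "I2 z d \<nu> = integral {0..d} (\<lambda>y. y powr \<nu> * exp (- y) * exp (- z * y powr (- 1/2)))"

text \<open>
  The parameters \<open>a\<^sub>1, \<dots>, a\<^sub>p\<close> and \<open>b\<^sub>1, \<dots>, b\<^sub>q\<close> of the Meijer \<open>G\<close>-function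
  are given as lists \<open>as\<close> and \<open>bs\<close>, so that \<open>p = length as\<close>, \<open>q = length bs\<close> and indices start
  at 0. It is understood that \<open>m \<le> q\<close>, \<open>n \<le> p\<close> and \<open>z \<noteq> 0\<close>. The power \<open>z powr (- s)\<close> is
  the principal one; for \<open>z > 0\<close> it is \<open>exp (- s * ln z)\<close> with the real logarithm.
\<close>

definition meijer_integrand ::
  "nat \<Rightarrow> nat \<Rightarrow> complex list \<Rightarrow> complex list \<Rightarrow> complex \<Rightarrow> complex \<Rightarrow> complex" where
  "meijer_integrand m n as bs z s =
     ((\<Prod>j<m. Gamma (bs ! j + s)) * (\<Prod>j<n. Gamma (1 - as ! j - s))) /
     ((\<Prod>j=m..<length bs. Gamma (1 - bs ! j - s)) * (\<Prod>j=n..<length as. Gamma (as ! j + s)))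
     * z powr (- s)"

text \<open>
  In the library \<open>Gamma\<close> is 0 at its poles, so a quotient by \<open>Gamma\<close> is 0 there, in agreement
  with the entire function \<open>1 / Gamma\<close>.
\<close>

definition meijer_poles_b :: "nat \<Rightarrow> complex list \<Rightarrow> complex set" where
  "meijer_poles_b m bs = {s. \<exists>j<m. bs ! j + s \<in> \<int>\<^sub>\<le>\<^sub>0}"

definition meijer_poles_a :: "nat \<Rightarrow> complex list \<Rightarrow> complex set" where
  "meijer_poles_a n as = {s. \<exists>j<n. 1 - as ! j - s \<in> \<int>\<^sub>\<le>\<^sub>0}"

text \<open>
  A loop beginning and ending at \<open>-\<infinity>\<close> is represented by its finite part, a path \<open>\<gamma>\<close>: the loop
  comes in along the horizontal ray from \<open>-\<infinity>\<close> to the start of \<open>\<gamma>\<close>, follows \<open>\<gamma>\<close>, and returns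
  along the horizontal ray from the end of \<open>\<gamma>\<close> to \<open>-\<infinity>\<close>. In \<open>loop_trunc \<gamma> T\<close> both rays are cut
  off to length \<open>T\<close>; \<open>loop_closed \<gamma> T\<close> joins the ends of the truncated loop by a segment. The
  winding number of the infinite loop about a point is the value that the winding number of the
  latter takes for all large \<open>T\<close>.
\<close>

definition loop_trunc :: "(real \<Rightarrow> complex) \<Rightarrow> real \<Rightarrow> real \<Rightarrow> complex" where
  "loop_trunc \<gamma> T =
     linepath (pathstart \<gamma> - of_real T) (pathstart \<gamma>) +++ \<gamma> +++
     linepath (pathfinish \<gamma>) (pathfinish \<gamma> - of_real T)"

definition loop_closed :: "(real \<Rightarrow> complex) \<Rightarrow> real \<Rightarrow> real \<Rightarrow> complex" where
  "loop_closed \<gamma> T =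
     loop_trunc \<gamma> T +++ linepath (pathfinish \<gamma> - of_real T) (pathstart \<gamma> - of_real T)"

definition loop_winds :: "(real \<Rightarrow> complex) \<Rightarrow> complex \<Rightarrow> complex \<Rightarrow> bool" where
  "loop_winds \<gamma> w k \<longleftrightarrow>
     (\<forall>\<^sub>F T in at_top. w \<notin> path_image (loop_closed \<gamma> T) \<and> winding_number (loop_closed \<gamma> T) w = k)"

definition meijer_loop ::
  "nat \<Rightarrow> nat \<Rightarrow> complex list \<Rightarrow> complex list \<Rightarrow> (real \<Rightarrow> complex) \<Rightarrow> bool" where
  "meijer_loop m n as bs \<gamma> \<longleftrightarrow>
     valid_path \<gamma> \<and>
     (\<forall>w \<in> meijer_poles_b m bs. loop_winds \<gamma> w 1) \<and>
     (\<forall>w \<in> meijer_poles_a n as. loop_winds \<gamma> w 0)"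

definition has_loop_integral :: "(complex \<Rightarrow> complex) \<Rightarrow> complex \<Rightarrow> (real \<Rightarrow> complex) \<Rightarrow> bool" where
  "has_loop_integral f I \<gamma> \<longleftrightarrow>
     ((\<lambda>T. contour_integral (loop_trunc \<gamma> T) f) \<longlongrightarrow> I) at_top"

text \<open>
  No loop exists if a pole of some \<open>Gamma (b\<^sub>j + s)\<close> coincides with a pole of some
  \<open>Gamma (1 - a\<^sub>j - s)\<close>. For \<open>q \<ge> 1\<close>, \<open>p < q\<close> and \<open>z \<noteq> 0\<close> the loop integral does not depend on
  the choice of the loop, by the residue theorem.
\<close>

definition meijer_G ::
  "nat \<Rightarrow> nat \<Rightarrow> complex list \<Rightarrow> complex list \<Rightarrow> complex \<Rightarrow> complex" where
  "meijer_G m n as bs z =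
     (THE g. \<exists>\<gamma> I. meijer_loop m n as bs \<gamma> \<and>
        has_loop_integral (meijer_integrand m n as bs z) I \<gamma> \<and>
        g = 1 / (2 * of_real pi * \<i>) * I)"

end

(*
  Write b = nu + r + 1 and c = z / sqrt d, so that the argument z^2/(4d) is c^2/4. Since
  Gamma(b + s) / Gamma(b + 1 + s) = 1/(b + s), the duplication formula turns the integrand of the
  G-function into 2 sqrt(pi) Gamma(2s) c^(-2s) / (s + b). Splitting the Euler integral,
    Gamma(2s) c^(-2s) = sum_k (-c)^k / (k! (2s + k)) + H(s)/2,
    H(s) = integral over 0 < t < 1 of t^(-s-1) exp(-c t^(-1/2)),
  where H is entire and bounded on a left half-plane. On a loop around all poles each term
  1/((2s + k)(s + b)) integrates to 0, even where -b is a double pole, and by Cauchy's formula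
  H(s)/(s + b) integrates to 2 pi i H(-b). So no residue needs to be computed, the value does not
  depend on the loop, and G = sqrt(pi) H(-b). Expanding exp(-y) in the integral I_2 and
  substituting y = d t gives the same terms.
*)
theory Submission
  imports Defs "HOL-Real_Asymp.Real_Asymp"
begin

subsection \<open>An incomplete Gamma integral\<close>

text \<open>The obstacle is that the rays of a loop run to -\<infinity> alongside infinitely many
  poles, so summing over the poles and letting the truncation length grow cannot simply be
  interchanged. The poles concerned are real, and they force both rays to run at nonzero height.
  There an arctangent bounds the integral of each term by a constant that depends neither on the
  pole nor on the truncation length, and the coefficients c^k / k! are summable, so dominated
  convergence for series applies. No asymptotics of Gamma on distant contours enters. The entire
  part is an integral over the compact interval [0,1] instead of [c,\<infinity>). Its variable t is
  already the rescaled variable of the integral to be expanded, the damping factor makes the kernel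
  continuous up to 0, and on (0,1] the modulus of t^(-s-1) is at most 1 once Re s \<le> -1. The last
  point is the boundedness on the left that lets the closing segment be pushed to -\<infinity>; it
  is also why the Euler integral is cut exactly at c, the point that corresponds to t = 1.\<close>

text \<open>For c > 0 the value 0 at \<open>t = 0\<close> is the limit from the right. Without the
  case distinction the convention \<open>ln 0 = 0\<close> would give the value 1 there and destroy
  continuity.\<close>

definition inc_kernel :: "real \<Rightarrow> complex \<Rightarrow> real \<Rightarrow> complex" where
  "inc_kernel c s t =
     (if t \<le> 0 then 0 else exp (- (s + 1) * of_real (ln t) - of_real (c * t powr (-1/2))))"

text \<open>
  The substitution \<open>v = t powr (-1/2)\<close> turns \<open>inc_gamma c s\<close> into
  \<open>2 * \<integral>\<^sub>1\<^sup>\<infinity> v powr (2 * s - 1) * exp (- c * v) dv\<close>, an incomplete Gamma integral at \<open>2 * s\<close>.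
\<close>

definition inc_gamma :: "real \<Rightarrow> complex \<Rightarrow> complex" where
  "inc_gamma c s = integral {0..1} (inc_kernel c s)"

lemma norm_inc_kernel:
  "t > 0 \<Longrightarrow> norm (inc_kernel c s t) = exp (- (Re s + 1) * ln t - c * t powr (-1/2))"
  by (simp add: inc_kernel_def)

text \<open>Near t = 0 the factor exp (- c * t powr (-1/2)) beats all powers of t and of ln t,
  locally uniformly in s. The case n = 0 yields integrability, n = 1 the derivative in s for
  differentiation under the integral.\<close>

lemma continuous_on_inc_kernel_aux:
  assumes c: "c > 0"
  shows "continuous_on (UNIV \<times> {0..1})
    (\<lambda>(s, t). of_real (ln t) ^ n * inc_kernel c s t)"
proof (clarsimp simp: continuous_on_eq_continuous_within)
  fix s0 :: complex and t0 :: real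
  assume t0: "0 \<le> t0" "t0 \<le> 1"
  let ?F = "\<lambda>(s::complex, t::real). of_real (ln t) ^ n * inc_kernel c s t"
  show "continuous (at (s0, t0) within UNIV \<times> {0..1}) ?F"
  proof (cases "t0 > 0")
    case True
    let ?G = "\<lambda>p::complex \<times> real. of_real (ln (snd p)) ^ n * exp (- (fst p + 1) * of_real (ln (snd p))
                - of_real (c * snd p powr (-1/2)))"
    have "continuous_on (UNIV \<times> {0<..}) ?G"
      by (intro continuous_intros) auto
    then have "continuous_on (UNIV \<times> {0<..}) ?F"
      by (rule continuous_on_eq) (auto simp: inc_kernel_def)
    moreover have "open (UNIV \<times> {0::real<..} :: (complex \<times> real) set)"
      by (intro open_Times) auto
    ultimately have "continuous (at (s0, t0)) ?F"
      using True by (subst (asm) continuous_on_eq_continuous_at) auto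
    then show ?thesis
      by (rule continuous_at_imp_continuous_at_within)
  next
    case False
    with t0 have [simp]: "t0 = 0" by simp
    \<comment> \<open>Within distance 1 of s0 one has Re s + 1 \<le> R. As ln t \<le> 0 on (0,1],
      \<open>m\<close> then majorizes the kernel by a function of t alone.\<close>
    define R where "R = \<bar>Re s0\<bar> + 2"
    define m where "m = (\<lambda>t::real. if t \<le> 0 then 0 else (- ln t) ^ n * exp (- R * ln t - c * t powr (-1/2)))"
    have "((\<lambda>t. (- ln t) ^ n * exp (- R * ln t - c * t powr (-1/2))) \<longlongrightarrow> 0) (at_right 0)"
      using c by real_asymp
    then have "(m \<longlongrightarrow> 0) (at_right 0)"
      by (rule Lim_transform_eventually)
         (auto simp: m_def eventually_at_right_less intro: eventually_at_rightI[of 0 1])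
    moreover have "(m \<longlongrightarrow> 0) (at_left 0)"
      by (rule tendsto_eventually) (auto simp: m_def intro: eventually_at_leftI[of "-1" 0])
    ultimately have "isCont m 0"
      by (simp add: isCont_def filterlim_split_at m_def)
    have "((\<lambda>p::complex \<times> real. snd p) \<longlongrightarrow> 0) (at (s0, 0) within UNIV \<times> {0..1})"
      by (rule tendsto_eq_intros | simp)+
    from isCont_tendsto_compose[OF \<open>isCont m 0\<close> this]
    have lim: "((\<lambda>p::complex \<times> real. m (snd p)) \<longlongrightarrow> 0) (at (s0, 0) within UNIV \<times> {0..1})"
      by (simp add: m_def)
    have "\<forall>\<^sub>F p in at (s0, 0::real) within UNIV \<times> {0..1}. dist p (s0, 0) < 1"
      by (auto simp: eventually_at intro!: exI[of _ 1])
    moreover have "\<forall>\<^sub>F p in at (s0, 0::real) within UNIV \<times> {0..1}. p \<in> UNIV \<times> {0..1}"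
      by (simp add: eventually_at_filter)
    ultimately have "\<forall>\<^sub>F p in at (s0, 0) within UNIV \<times> {0..1}. norm (?F p) \<le> m (snd p)"
    proof eventually_elim
      case (elim p)
      obtain s t where p: "p = (s, t)" by fastforce
      have "norm (s - s0) < 1"
        using elim(1) dist_fst_le[of p "(s0, 0)"] by (simp add: p dist_norm)
      then have "\<bar>Re s - Re s0\<bar> < 1"
        using abs_Re_le_cmod[of "s - s0"] by simp
      then have R: "Re s + 1 \<le> R" by (simp add: R_def)
      show ?case
      proof (cases "t = 0")
        case True
        then show ?thesis by (simp add: p m_def inc_kernel_def)
      next
        case False
        with elim have t: "0 < t" "t \<le> 1" by (auto simp: p)
        then have "(- (Re s + 1)) * ln t \<le> (- R) * ln t"
          using R by (intro mult_right_mono_neg) auto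
        with t show ?thesis
          by (auto simp: p m_def norm_mult norm_power norm_inc_kernel intro!: mult_left_mono)
      qed
    qed
    from Lim_null_comparison[OF this lim] show ?thesis
      by (simp add: continuous_within inc_kernel_def)
  qed
qed

lemma continuous_on_inc_kernel: "c > 0 \<Longrightarrow> continuous_on {0..1} (inc_kernel c s)"
  using continuous_on_compose2[OF continuous_on_inc_kernel_aux[of c 0], of "{0..1}" "\<lambda>t. (s, t)"]
  by (simp add: continuous_on_Pair image_subset_iff)

lemma integrable_inc_kernel: "c > 0 \<Longrightarrow> inc_kernel c s integrable_on {0..1}"
  by (intro integrable_continuous_interval continuous_on_inc_kernel)

lemma holomorphic_inc_gamma:
  assumes "c > 0"
  shows "inc_gamma c holomorphic_on UNIV"
proof -
  have "(\<lambda>s. integral (cbox 0 1) (inc_kernel c s)) holomorphic_on UNIV"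
  proof (rule leibniz_rule_holomorphic)
    show "((\<lambda>s. inc_kernel c s t) has_field_derivative - (of_real (ln t) * inc_kernel c s t)) (at s within UNIV)"
      for s t
      by (cases "t \<le> 0") (auto simp: inc_kernel_def intro!: derivative_eq_intros)
    show "inc_kernel c s integrable_on cbox 0 1" for s
      using integrable_inc_kernel[OF assms] by simp
    show "continuous_on (UNIV \<times> cbox 0 1) (\<lambda>(s, t). - (of_real (ln t) * inc_kernel c s t))"
      using continuous_on_minus[OF continuous_on_inc_kernel_aux[OF assms, of 1]]
      by (simp add: case_prod_unfold)
  qed auto
  then show ?thesis
    by (simp add: inc_gamma_def[abs_def])
qed

text \<open>Both factors of the kernel have modulus at most 1 when Re s \<le> -1. This feeds the
  estimate on the closing segment in \<open>loop_integral_cauchy\<close>.\<close>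

lemma norm_inc_gamma_le_1:
  assumes c: "c > 0" and s: "Re s \<le> -1"
  shows "norm (inc_gamma c s) \<le> 1"
proof -
  have "norm (inc_kernel c s t) \<le> 1" if t: "t \<in> {0..1}" for t
  proof (cases "t = 0")
    case False
    with t have t: "0 < t" "t \<le> 1" by auto
    then have "- (Re s + 1) * ln t \<le> 0"
      using s by (intro mult_nonneg_nonpos) auto
    moreover have "0 \<le> c * t powr (-1/2)" using c by simp
    ultimately show ?thesis
      by (simp only: norm_inc_kernel[OF t(1)] exp_le_one_iff)
  qed (simp add: inc_kernel_def)
  then have "norm (integral {0..1} (inc_kernel c s)) \<le> integral {0..1} (\<lambda>t::real. 1::real)"
    using integrable_inc_kernel[OF c, of s] by (intro integral_norm_bound_integral) auto
  then show ?thesis by (simp add: inc_gamma_def)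
qed

section \<open>Termwise integration against the exponential series\<close>

text \<open>A continuous h is bounded on the compact interval, so the exponential series times h
  converges uniformly. It serves twice: for the part of the Euler integral over [0,c], and for the
  integral \<open>I2\<close>.\<close>

lemma sums_integral_exp_minus:
  fixes h :: "real \<Rightarrow> real"
  assumes h: "continuous_on {0..d} h"
  shows "(\<lambda>k. (-1) ^ k / fact k * integral {0..d} (\<lambda>t. h t * t ^ k)) sums
           integral {0..d} (\<lambda>t. h t * exp (- t))"
proof -
  have "bounded (h ` {0..d})"
    by (intro compact_imp_bounded compact_continuous_image h) auto
  then obtain B where B: "\<forall>t\<in>{0..d}. norm (h t) \<le> B"
    by (auto simp: bounded_iff)
  define f where "f = (\<lambda>k t. (-1) ^ k / fact k * (h t * t ^ k))"
  have bound: "norm (f k t) \<le> B * (\<bar>d\<bar> ^ k / fact k)" if t: "t \<in> {0..d}" for k t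
  proof -
    have "\<bar>h t\<bar> * (t ^ k / fact k) \<le> B * (\<bar>d\<bar> ^ k / fact k)"
      using t B by (intro mult_mono divide_right_mono power_mono) auto
    with t show ?thesis by (simp add: f_def abs_mult power_abs field_simps)
  qed
  have "summable (\<lambda>k. B * (\<bar>d\<bar> ^ k / fact k))"
    using summable_exp[of "\<bar>d\<bar>"] by (intro summable_mult) (simp add: field_simps)
  from Weierstrass_m_test[OF bound this]
  have "uniform_limit {0..d} (\<lambda>n t. \<Sum>k<n. f k t) (\<lambda>t. \<Sum>k. f k t) sequentially" .
  moreover have exp: "(\<Sum>k. f k t) = h t * exp (- t)" for t
  proof -
    have "(\<lambda>k. h t * ((- t) ^ k /\<^sub>R fact k)) sums (h t * exp (- t))"
      by (intro sums_mult exp_converges)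
    moreover have "h t * ((- t) ^ k /\<^sub>R fact k) = f k t" for k
      by (simp add: f_def power_minus[of t] field_simps)
    ultimately show ?thesis by (simp add: sums_iff)
  qed
  ultimately have lim: "uniform_limit {0..d} (\<lambda>n t. \<Sum>k<n. f k t) (\<lambda>t. h t * exp (- t)) sequentially"
    by simp
  have cont: "continuous_on {0..d} (\<lambda>t. \<Sum>k<n. f k t)" for n
    unfolding f_def by (intro continuous_intros h)
  have int: "(\<lambda>t. h t * t ^ k) integrable_on {0..d}" for k
    by (intro integrable_continuous_interval continuous_intros h)
  obtain I J where IJ: "\<And>n. ((\<lambda>t. \<Sum>k<n. f k t) has_integral I n) {0..d}"
      "((\<lambda>t. h t * exp (- t)) has_integral J) {0..d}" "I \<longlonglongrightarrow> J"
    using uniform_limit_integral[OF lim cont] by auto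
  have I: "I n = (\<Sum>k<n. (-1) ^ k / fact k * integral {0..d} (\<lambda>t. h t * t ^ k))" for n
  proof (rule has_integral_unique[OF IJ(1)])
    show "((\<lambda>t. \<Sum>k<n. f k t) has_integral
        (\<Sum>k<n. (-1) ^ k / fact k * integral {0..d} (\<lambda>t. h t * t ^ k))) {0..d}"
      unfolding f_def
      by (intro has_integral_sum has_integral_mult_right integrable_integral int) auto
  qed
  have "J = integral {0..d} (\<lambda>t. h t * exp (- t))"
    using IJ(2) by (simp add: integral_unique)
  moreover from I have "I = (\<lambda>n. \<Sum>k<n. (-1) ^ k / fact k * integral {0..d} (\<lambda>t. h t * t ^ k))"
    by blast
  ultimately show ?thesis
    using IJ(3) by (simp only: sums_def)
qed

subsection \<open>The splitting of the Gamma function into its poles and an entire part\<close>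

text \<open>For Re s > 0 this is the integral of t^(2s-1) exp(-t) over [0,c], taken term by term and
  divided by c^(2s).\<close>

definition pole_series :: "real \<Rightarrow> complex \<Rightarrow> complex" where
  "pole_series c s = (\<Sum>k. of_real ((- c) ^ k / fact k) / (2 * s + of_nat k))"

abbreviation half_poles :: "complex set" where
  "half_poles \<equiv> {s. 2 * s \<in> \<int>\<^sub>\<le>\<^sub>0}"

section \<open>The Euler integral at real arguments, cut at c\<close>

lemma inc_kernel_of_real:
  "inc_kernel c (of_real x) t =
     of_real (if t \<le> 0 then 0 else exp (- (x + 1) * ln t - c * t powr (-1/2)))"
  by (simp add: inc_kernel_def flip: exp_of_real)

lemma inc_gamma_of_real:
  assumes "c > 0"
  shows "inc_gamma c (of_real x) = of_real (integral {0..1} (\<lambda>t. Re (inc_kernel c (of_real x) t)))"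
proof -
  have "integral {0..1} (inc_kernel c (of_real x)) \<in> \<real>"
    using integral_linear[OF integrable_inc_kernel[OF assms] bounded_linear_Im, of "of_real x"]
    by (simp add: complex_is_Real_iff o_def inc_kernel_of_real)
  moreover have "Re (integral {0..1} (inc_kernel c (of_real x))) =
      integral {0..1} (\<lambda>t. Re (inc_kernel c (of_real x) t))"
    using integral_linear[OF integrable_inc_kernel[OF assms] bounded_linear_Re, of "of_real x"]
    by (simp add: o_def)
  ultimately show ?thesis
    by (simp add: inc_gamma_def complex_is_Real_iff complex_eq_iff)
qed

text \<open>For x > 1 the power t powr (2x - 1) is continuous at 0, so
  \<open>sums_integral_exp_minus\<close> applies. Other arguments are reached later by analytic
  continuation.\<close>

lemma lower_gamma_series:
  fixes x c :: real
  assumes "c > 0" "x > 1"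
  shows "(\<lambda>k. c powr (2 * x) * ((- c) ^ k / fact k / (2 * x + real k))) sums
           integral {0..c} (\<lambda>t. t powr (2 * x - 1) / exp t)"
proof -
  have cont: "continuous_on {0..c} (\<lambda>t. t powr (2 * x - 1))"
    using assms by (intro continuous_on_powr' continuous_intros) auto
  have int: "integral {0..c} (\<lambda>t. t powr (2 * x - 1) * t ^ k) = c powr (2 * x + k) / (2 * x + k)" for k
  proof -
    have "((\<lambda>t. t powr (2 * x - 1 + k)) has_integral
        (c powr (2 * x - 1 + k + 1) / (2 * x - 1 + k + 1))) {0..c}"
      using assms by (intro has_integral_powr_from_0) auto
    then have "((\<lambda>t. t powr (2 * x - 1) * t ^ k) has_integral
        (c powr (2 * x - 1 + k + 1) / (2 * x - 1 + k + 1))) {0..c}"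
    proof (rule has_integral_eq[rotated])
      fix t assume "t \<in> {0..c}"
      then show "t powr (2 * x - 1 + real k) = t powr (2 * x - 1) * t ^ k"
        by (cases "t = 0") (auto simp: powr_add powr_realpow)
    qed
    then show ?thesis by (simp add: integral_unique add.commute)
  qed
  have coeff: "(-1) ^ k / fact k * (c powr (2 * x + k) / (2 * x + k)) =
      c powr (2 * x) * ((- c) ^ k / fact k / (2 * x + real k))" for k
    using assms by (simp add: powr_add powr_realpow power_minus[of c])
  have "(\<lambda>t. t powr (2 * x - 1) * exp (- t)) = (\<lambda>t. t powr (2 * x - 1) / exp t)"
    by (simp add: exp_minus field_class.field_divide_inverse)
  then show ?thesis
    using sums_integral_exp_minus[OF cont] by (simp only: int coeff)
qed

text \<open>The substitution v = c * u powr (-1/2) maps (0,1] decreasingly onto [c,\<infinity>). The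
  change of variables theorem carries integrability over as well, from the bounded interval to the
  unbounded one.\<close>

lemma upper_gamma_integral:
  fixes x c :: real
  assumes "c > 0" "x > 1"
  shows "(\<lambda>t. t powr (2 * x - 1) / exp t) integrable_on {c..}"
    and "integral {c..} (\<lambda>t. t powr (2 * x - 1) / exp t) =
           c powr (2 * x) / 2 * integral {0..1} (\<lambda>t. Re (inc_kernel c (of_real x) t))"
proof -
  let ?f = "\<lambda>t. t powr (2 * x - 1) / exp t"
  let ?g = "\<lambda>u. c * u powr (-1/2)" and ?g' = "\<lambda>u. - (c / 2) * u powr (-3/2)"
  let ?k = "\<lambda>t. Re (inc_kernel c (of_real x) t)"
  have img: "?g ` {0<..1} = {c..}"
  proof (intro equalityI subsetI)
    fix v assume "v \<in> ?g ` {0<..1}"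
    then obtain u where u: "u \<in> {0<..1}" and v: "v = ?g u" by blast
    from u have "1 \<le> u powr (-1/2)" using powr_mono2'[of "-1/2" u 1] by auto
    then show "v \<in> {c..}"
      using assms v by auto
  next
    fix v assume v: "v \<in> {c..}"
    then have "0 < c / v" "c / v \<le> 1" using assms by auto
    \<comment> \<open>The witness solves v = c * u powr (-1/2) for u.\<close>
    moreover have "v = ?g ((c / v) ^ 2)"
      using v assms by (simp add: powr_minus powr_half_sqrt real_sqrt_divide field_simps)
    ultimately show "v \<in> ?g ` {0<..1}"
      by (intro image_eqI[of _ _ "(c / v) ^ 2"]) (auto simp: power_le_one)
  qed
  have eq: "\<bar>?g' u\<bar> * ?f (?g u) = c powr (2 * x) / 2 * ?k u" if u: "u \<in> {0<..1}" for u
  proof -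
    have "(-1/2) * (2 * x - 1) = 1/2 - x" by (simp add: field_simps)
    then have 1: "?g u powr (2 * x - 1) = c powr (2 * x - 1) * u powr (1/2 - x)"
      using u assms by (simp only: powr_powr powr_mult)
    have 2: "c * c powr (2 * x - 1) = c powr (2 * x)"
      using assms powr_add[of c 1 "2 * x - 1"] by simp
    have 3: "u powr (-3/2) * u powr (1/2 - x) = exp (- (x + 1) * ln u)"
      using u by (simp add: powr_def flip: exp_add) (simp add: field_simps)
    have 4: "exp (- (x + 1) * ln u) * exp (- ?g u) = ?k u"
      using u by (simp add: inc_kernel_of_real flip: exp_add)
    have "\<bar>?g' u\<bar> * ?f (?g u) = c / 2 * u powr (-3/2) * (?g u powr (2 * x - 1) * exp (- ?g u))"
      using assms by (simp add: abs_mult exp_minus field_simps)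
    also have "\<dots> = c * c powr (2 * x - 1) / 2 * (u powr (-3/2) * u powr (1/2 - x) * exp (- ?g u))"
      unfolding 1 by simp
    also have "\<dots> = c powr (2 * x) / 2 * ?k u"
      unfolding 2 3 4 ..
    finally show ?thesis .
  qed
  have kint: "?k integrable_on {0..1}"
    using integrable_linear[OF integrable_inc_kernel[OF assms(1)] bounded_linear_Re, of "of_real x"]
    by (simp add: o_def)
  \<comment> \<open>The substitution is singular at 0, so this point is dropped as a null
    set.\<close>
  moreover have "negligible ({0<..1::real} - {0..1} \<union> ({0..1} - {0<..1}))"
    by (rule negligible_subset[of "{0}"]) auto
  ultimately have k: "(?k has_integral integral {0..1} ?k) {0<..1}"
    by (subst has_integral_spike_set_eq[of _ "{0..1}"])
       (auto intro: negligible_subset[of "{0}"] integrable_integral)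
  have "((\<lambda>u. \<bar>?g' u\<bar> * ?f (?g u)) has_integral c powr (2 * x) / 2 * integral {0..1} ?k) {0<..1}"
    using has_integral_mult_right[OF k, of "c powr (2 * x) / 2"] eq
    by (subst has_integral_cong) auto
  \<comment> \<open>Nonnegativity of the integrand supplies the absolute integrability on which the
    change of variables theorem is based.\<close>
  then have "(\<lambda>u. \<bar>?g' u\<bar> * ?f (?g u)) absolutely_integrable_on {0<..1} \<and>
      integral {0<..1} (\<lambda>u. \<bar>?g' u\<bar> * ?f (?g u)) = c powr (2 * x) / 2 * integral {0..1} ?k"
    by (auto intro!: nonnegative_absolutely_integrable_1 simp: integral_unique has_integral_integrable)
  moreover have "(?g has_field_derivative ?g' u) (at u within {0<..1})" if "u \<in> {0<..1}" for u
    using that by (auto intro!: derivative_eq_intros simp: powr_diff field_simps)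
  moreover have "inj_on ?g {0<..1}"
    by (rule inj_on_inverseI[where g = "\<lambda>v. (v / c) powr (-2)"]) (use assms in \<open>simp add: powr_powr\<close>)
  ultimately have "?f absolutely_integrable_on {c..} \<and>
      integral {c..} ?f = c powr (2 * x) / 2 * integral {0..1} ?k"
    unfolding img[symmetric]
    by (subst has_absolute_integral_change_of_variables_1'[of "{0<..1}" ?g ?g' ?f, symmetric]) auto
  then show "?f integrable_on {c..}"
    "integral {c..} ?f = c powr (2 * x) / 2 * integral {0..1} ?k"
    using set_lebesgue_integral_eq_integral(1) by auto
qed

lemma Gamma_double_real:
  assumes "c > 0" "x > 1"
  shows "of_real (Gamma (2 * x)) = of_real (c powr (2 * x)) * (pole_series c (of_real x) + inc_gamma c (of_real x) / 2)"
proof -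
  let ?f = "\<lambda>t. t powr (2 * x - 1) / exp t"
  let ?k = "\<lambda>t. Re (inc_kernel c (of_real x) t)"
  note series = lower_gamma_series[OF assms]
  have sm: "summable (\<lambda>k. (- c) ^ k / fact k / (2 * x + real k))"
    using sums_summable[OF series] assms by (subst (asm) summable_cmult_iff) auto
  have "(\<lambda>k. of_real ((- c) ^ k / fact k / (2 * x + real k))) sums
          complex_of_real (\<Sum>k. (- c) ^ k / fact k / (2 * x + real k))"
    by (intro sums_of_real summable_sums sm)
  then have ps: "pole_series c (of_real x) = of_real (\<Sum>k. (- c) ^ k / fact k / (2 * x + real k))"
    by (simp add: pole_series_def sums_iff)
  have low: "integral {0..c} ?f = c powr (2 * x) * (\<Sum>k. (- c) ^ k / fact k / (2 * x + real k))"
    by (rule sums_unique2[OF series sums_mult[OF summable_sums[OF sm]]])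
  have "continuous_on {0..c} ?f"
    using assms by (intro continuous_on_powr' continuous_intros) auto
  then have "(?f has_integral integral {0..c} ?f) {0..c}"
    by (intro integrable_integral integrable_continuous_interval)
  moreover have "(?f has_integral integral {c..} ?f) {c..}"
    by (intro integrable_integral upper_gamma_integral(1)[OF assms])
  moreover have "negligible ({0..c} \<inter> {c..})"
    by (rule negligible_subset[of "{c}"]) auto
  ultimately have "(?f has_integral integral {0..c} ?f + integral {c..} ?f) ({0..c} \<union> {c..})"
    by (rule has_integral_Un)
  moreover have "{0..c} \<union> {c..} = {0..}" using assms by auto
  ultimately have "Gamma (2 * x) = integral {0..c} ?f + integral {c..} ?f"
    using Gamma_integral_real[of "2 * x"] assms by (auto intro: has_integral_unique)
  then show ?thesis
    unfolding low upper_gamma_integral(2)[OF assms] ps inc_gamma_of_real[OF assms(1)]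
    by (simp add: algebra_simps)
qed

section \<open>The pole set and analytic continuation\<close>

lemma closed_half_poles: "closed half_poles"
  using closed_vimage[of "\<int>\<^sub>\<le>\<^sub>0 :: complex set" "\<lambda>s. 2 * s"]
  by (auto simp: vimage_def intro: continuous_intros)

lemma half_polesI: "- (of_nat k / 2) \<in> half_poles"
  by simp

text \<open>Countability makes the complement connected, as the identity theorem in
  \<open>Gamma_double\<close> requires.\<close>

lemma countable_half_poles: "countable half_poles"
proof -
  have "half_poles \<subseteq> range (\<lambda>k. - (of_nat k / 2))"
  proof
    fix s :: complex assume "s \<in> half_poles"
    then obtain k where "2 * s = - of_nat k" by (auto elim: nonpos_Ints_cases')
    then have "s = - (of_nat k / 2)" by (simp add: field_simps)
    then show "s \<in> range (\<lambda>k. - (of_nat k / 2))" by blast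
  qed
  then show ?thesis by (rule countable_subset) simp
qed

text \<open>The modulus of 2s + k is twice the distance from s to the pole -k/2. The bound is the
  same for all s at distance \<delta> from the poles, so convergence is uniform even on unbounded
  sets.\<close>

lemma norm_pole_series_term:
  assumes "c > 0" "\<delta> > 0" and "\<And>p. p \<in> half_poles \<Longrightarrow> \<delta> \<le> dist s p"
  shows "norm (of_real ((- c) ^ k / fact k) / (2 * s + of_nat k)) \<le> c ^ k / fact k / \<delta>"
proof -
  have "\<delta> \<le> norm (s + of_nat k / 2)"
    using assms(3)[OF half_polesI, of k] by (simp add: dist_norm)
  also have "\<dots> \<le> norm (2 * (s + of_nat k / 2))"
    by (subst norm_mult) simp
  also have "2 * (s + of_nat k / 2) = 2 * s + of_nat k"
    by simp
  finally have "\<delta> \<le> norm (2 * s + of_nat k)" .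
  then have "c ^ k / fact k / norm (2 * s + of_nat k) \<le> c ^ k / fact k / \<delta>"
    using assms by (intro divide_left_mono mult_pos_pos) auto
  with assms(1) show ?thesis
    by (simp add: norm_divide norm_power del: of_real_divide of_real_power)
qed

lemma summable_exp_coeffs: "summable (\<lambda>k. c ^ k / fact k / (\<delta>::real))"
  using summable_exp[of c] by (intro summable_divide) (simp add: field_simps)

lemma uniform_limit_pole_series:
  assumes "c > 0" "\<delta> > 0" and "\<And>s p. s \<in> A \<Longrightarrow> p \<in> half_poles \<Longrightarrow> \<delta> \<le> dist s p"
  shows "uniform_limit A (\<lambda>n s. \<Sum>k<n. of_real ((- c) ^ k / fact k) / (2 * s + of_nat k))
           (pole_series c) sequentially"
  unfolding pole_series_def[abs_def]
  by (rule Weierstrass_m_test[OF norm_pole_series_term[where \<delta> = \<delta>] summable_exp_coeffs])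
     (use assms in auto)

lemma holomorphic_pole_series:
  assumes "c > 0"
  shows "pole_series c holomorphic_on - half_poles"
proof (rule holomorphic_uniform_sequence)
  show op: "open (- half_poles)"
    using closed_half_poles by (rule open_Compl)
  show "(\<lambda>s. \<Sum>k<n. of_real ((- c) ^ k / fact k) / (2 * s + of_nat k)) holomorphic_on - half_poles" for n
  proof (intro holomorphic_intros)
    fix s k assume "s \<in> - half_poles"
    moreover have "2 * s = - of_nat k" if "2 * s + of_nat k = 0"
      using that by (simp add: eq_neg_iff_add_eq_0)
    ultimately show "2 * s + of_nat k \<noteq> 0"
      by auto
  qed
  fix s :: complex assume "s \<in> - half_poles"
  with op obtain e where e: "e > 0" "ball s e \<subseteq> - half_poles"
    using open_contains_ball by blast
  \<comment> \<open>Halving the radius keeps the smaller closed ball at distance e/2 from everything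
    outside the larger ball.\<close>
  have "e / 2 \<le> dist u p" if "u \<in> cball s (e / 2)" "p \<in> half_poles" for u p
  proof -
    have "p \<notin> ball s e" using that e by blast
    then show ?thesis using that(1) dist_triangle[of s p u] by simp
  qed
  with e assms show "\<exists>d. 0 < d \<and> cball s d \<subseteq> - half_poles \<and> uniform_limit (cball s d)
      (\<lambda>n s. \<Sum>k<n. of_real ((- c) ^ k / fact k) / (2 * s + of_nat k)) (pole_series c) sequentially"
    by (intro exI[of _ "e / 2"] conjI uniform_limit_pole_series[where \<delta> = "e / 2"]) fastforce+
qed

text \<open>Both sides are holomorphic off the poles and agree for real s > 1, a set that
  accumulates at 2; the identity theorem does the rest.\<close>

lemma Gamma_double:
  assumes c: "c > 0" and s: "2 * s \<notin> \<int>\<^sub>\<le>\<^sub>0"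
  shows "Gamma (2 * s) * of_real c powr (- 2 * s) = pole_series c s + inc_gamma c s / 2"
proof -
  let ?D = "\<lambda>s. Gamma (2 * s) * of_real c powr (- 2 * s) - (pole_series c s + inc_gamma c s / 2)"
  have "?D s = 0"
  proof (rule analytic_continuation[of ?D "- half_poles" "of_real ` {1::real<..}" 2])
    show "?D holomorphic_on - half_poles"
      using c by (intro holomorphic_intros holomorphic_pole_series
          holomorphic_on_subset[OF holomorphic_inc_gamma]) auto
    show "open (- half_poles)"
      using closed_half_poles by (rule open_Compl)
    show "connected (- half_poles)"
      using connected_open_diff_countable[OF _ open_UNIV connected_UNIV countable_half_poles]
      by (simp add: Compl_eq_Diff_UNIV)
    show "of_real ` {1::real<..} \<subseteq> - half_poles"
    proof -
      have "2 * of_real x \<notin> (\<int>\<^sub>\<le>\<^sub>0 :: complex set)" if "x > 1" for x :: real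
      proof
        assume "2 * of_real x \<in> (\<int>\<^sub>\<le>\<^sub>0 :: complex set)"
        then obtain n where "2 * of_real x = (- of_nat n :: complex)"
          by (elim nonpos_Ints_cases')
        from arg_cong[OF this, of Re] that show False by simp
      qed
      then show ?thesis by auto
    qed
    show "(2::complex) \<in> - half_poles"
      by auto
    show "(2::complex) islimpt of_real ` {1::real<..}"
    proof (clarsimp simp: islimpt_approachable)
      fix e :: real assume "e > 0"
      then show "\<exists>x\<in>{1<..}. of_real x \<noteq> (2::complex) \<and> dist (of_real x) (2::complex) < e"
        by (intro bexI[of _ "2 + e / 2"]) (auto simp: dist_norm norm_divide)
    qed
    show "?D z = 0" if z: "z \<in> of_real ` {1::real<..}" for z
    proof -
      obtain x where x: "z = of_real x" "x > 1" using z by auto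
      have e: "- 2 * z = of_real (- 2 * x)" "2 * z = of_real (2 * x)" by (simp_all add: x(1))
      have 1: "of_real c powr (- 2 * z) = complex_of_real (c powr (- 2 * x))"
        unfolding e(1) using c by (intro powr_of_real) simp
      have 2: "Gamma (2 * z) = of_real (Gamma (2 * x))"
        unfolding e(2) by (rule Gamma_complex_of_real)
      have "complex_of_real (c powr (2 * x)) * of_real (c powr (- 2 * x)) = of_real (c powr (2 * x) * c powr (- 2 * x))"
        by (rule of_real_mult[symmetric])
      also have "c powr (2 * x) * c powr (- 2 * x) = 1"
        using c by (simp flip: powr_add)
      finally have 3: "complex_of_real (c powr (2 * x)) * of_real (c powr (- 2 * x)) = 1" by simp
      have "Gamma (2 * z) * of_real c powr (- 2 * z) = (complex_of_real (c powr (2 * x)) * of_real (c powr (- 2 * x))) * (pole_series c (of_real x) + inc_gamma c (of_real x) / 2)"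
        unfolding 1 2 Gamma_double_real[OF c x(2)] by (simp only: mult_ac)
      then show ?thesis unfolding 3 by (simp add: x(1))
    qed
  qed (use s in auto)
  then show ?thesis by simp
qed

subsection \<open>Integrals along loops\<close>

lemma pathstart_loop_trunc [simp]: "pathstart (loop_trunc \<gamma> T) = pathstart \<gamma> - of_real T"
  and pathfinish_loop_trunc [simp]: "pathfinish (loop_trunc \<gamma> T) = pathfinish \<gamma> - of_real T"
  by (simp_all add: loop_trunc_def)

lemma valid_path_loop_trunc [simp]: "valid_path \<gamma> \<Longrightarrow> valid_path (loop_trunc \<gamma> T)"
  by (auto simp: loop_trunc_def intro!: valid_path_join)

lemma valid_path_loop_closed [simp]: "valid_path \<gamma> \<Longrightarrow> valid_path (loop_closed \<gamma> T)"
  by (auto simp: loop_closed_def intro!: valid_path_join)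

lemma pathstart_loop_closed [simp]: "pathstart (loop_closed \<gamma> T) = pathstart \<gamma> - of_real T"
  and pathfinish_loop_closed [simp]: "pathfinish (loop_closed \<gamma> T) = pathstart \<gamma> - of_real T"
  by (simp_all add: loop_closed_def)

lemma path_image_loop_trunc:
  "path_image (loop_trunc \<gamma> T) = closed_segment (pathstart \<gamma> - of_real T) (pathstart \<gamma>) \<union>
     path_image \<gamma> \<union> closed_segment (pathfinish \<gamma>) (pathfinish \<gamma> - of_real T)"
  by (simp add: loop_trunc_def path_image_join Un_assoc)

lemma path_image_loop_closed:
  "path_image (loop_closed \<gamma> T) = path_image (loop_trunc \<gamma> T) \<union>
     closed_segment (pathfinish \<gamma> - of_real T) (pathstart \<gamma> - of_real T)"
  by (simp add: loop_closed_def path_image_join)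

lemma closed_segment_horizontal_mono:
  assumes "0 \<le> T" "T \<le> T'"
  shows "closed_segment a (a - of_real T) \<subseteq> closed_segment a (a - complex_of_real T')"
proof (cases "T = 0")
  case False
  have "a - of_real T \<in> closed_segment a (a - complex_of_real T')"
    using assms False unfolding closed_segment_def
    by (auto intro!: exI[of _ "T / T'"] simp: scaleR_conv_of_real algebra_simps)
  then show ?thesis
    by (simp add: closed_segment_subset)
qed auto

lemma path_image_loop_trunc_mono:
  assumes "0 \<le> T" "T \<le> T'"
  shows "path_image (loop_trunc \<gamma> T) \<subseteq> path_image (loop_trunc \<gamma> T')"
  using closed_segment_horizontal_mono[OF assms]
  unfolding path_image_loop_trunc
  by (subst (1 2) closed_segment_commute[of "pathstart \<gamma> - _"]) blast

text \<open>The definition of \<open>loop_winds\<close> only speaks of large T, but the truncated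
  loops grow with T, so a point missed by a long one is missed by all shorter ones.\<close>

lemma loop_winds_notin:
  assumes "loop_winds \<gamma> w k" "T \<ge> 0"
  shows "w \<notin> path_image (loop_trunc \<gamma> T)"
proof -
  have "\<forall>\<^sub>F T' in at_top. w \<notin> path_image (loop_closed \<gamma> T') \<and> T \<le> T'"
    using assms(1) eventually_ge_at_top[of T] unfolding loop_winds_def
    by eventually_elim auto
  then obtain T' where "w \<notin> path_image (loop_closed \<gamma> T')" "T \<le> T'"
    using eventually_happens'[OF trivial_limit_at_top_linorder] by blast
  then show ?thesis
    using path_image_loop_trunc_mono[OF assms(2), of T' \<gamma>] by (auto simp: path_image_loop_closed)
qed

lemma Re_le_on_segment:
  assumes "w \<in> closed_segment a b" "Re a \<le> R" "Re b \<le> R"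
  shows "Re w \<le> R"
proof -
  have "closed_segment a b \<subseteq> {z. Re z \<le> R}"
    using assms by (intro closed_segment_subset convex_halfspace_Re_le) auto
  then show ?thesis using assms by auto
qed

text \<open>Cauchy's formula holds for the closed truncated loop. Its closing segment has a length
  independent of T, while H stays bounded on it and 1 / (s - q) decays like 1 / T, so the segment
  contributes nothing in the limit.\<close>

lemma loop_integral_cauchy:
  assumes \<gamma>: "valid_path \<gamma>" and H: "H holomorphic_on UNIV"
    and bound: "\<And>s. Re s \<le> r \<Longrightarrow> norm (H s) \<le> B" and q: "loop_winds \<gamma> q 1"
  shows "((\<lambda>T. contour_integral (loop_trunc \<gamma> T) (\<lambda>s. H s / (s - q))) \<longlongrightarrow>
            2 * of_real pi * \<i> * H q) at_top"
proof -
  define R where "R = max (Re (pathstart \<gamma>)) (Re (pathfinish \<gamma>))"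
  define D where "D = norm (pathstart \<gamma> - pathfinish \<gamma>)"
  let ?f = "\<lambda>s. H s / (s - q)"
  let ?I = "\<lambda>T. contour_integral (loop_trunc \<gamma> T) ?f"
  have "0 \<le> B" using bound[of "of_real r"] by (smt (verit) norm_ge_zero Re_complex_of_real)
  have "((\<lambda>T. ?I T - 2 * of_real pi * \<i> * H q) \<longlongrightarrow> 0) at_top"
  proof (rule Lim_null_comparison)
    show "((\<lambda>T. B / (T - R + Re q) * D) \<longlongrightarrow> 0) at_top"
      by real_asymp
    \<comment> \<open>The first condition puts the closing segment into the half-plane where H is
      bounded, the second puts it strictly to the left of q.\<close>
    have "\<forall>\<^sub>F T in at_top. T > R - r" "\<forall>\<^sub>F T in at_top. T > R - Re q"
      by (rule eventually_gt_at_top)+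
    with q[unfolded loop_winds_def]
    show "\<forall>\<^sub>F T in at_top. norm (?I T - 2 * of_real pi * \<i> * H q) \<le> B / (T - R + Re q) * D"
    proof eventually_elim
      case (elim T)
      let ?seg = "linepath (pathfinish \<gamma> - of_real T) (pathstart \<gamma> - of_real T)"
      have "path_image (loop_closed \<gamma> T) \<subseteq> UNIV - {q}" using elim by auto
      then have "(?f has_contour_integral (2 * of_real pi * \<i> * winding_number (loop_closed \<gamma> T) q * H q))
              (loop_closed \<gamma> T)"
        using Cauchy_integral_formula_convex_simple[of UNIV H q "loop_closed \<gamma> T"] H \<gamma>
        by simp
      with elim have I: "(?f has_contour_integral (2 * of_real pi * \<i> * H q)) (loop_trunc \<gamma> T +++ ?seg)"
        by (simp add: loop_closed_def)
      then have int: "?f contour_integrable_on loop_trunc \<gamma> T" "?f contour_integrable_on ?seg"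
        using \<gamma> by (metis contour_integrable_on_def contour_integrable_join valid_path_loop_trunc valid_path_linepath)+
      have "?I T + contour_integral ?seg ?f = 2 * of_real pi * \<i> * H q"
        using contour_integral_unique[OF I] int \<gamma> by simp
      then have "?I T - 2 * of_real pi * \<i> * H q = - contour_integral ?seg ?f"
        by (simp add: algebra_simps)
      also have "norm \<dots> \<le> B / (T - R + Re q) * norm ((pathstart \<gamma> - of_real T) - (pathfinish \<gamma> - of_real T))"
        unfolding norm_minus_cancel
      proof (rule contour_integral_bound_linepath[OF int(2)])
        show "0 \<le> B / (T - R + Re q)" using \<open>0 \<le> B\<close> elim by auto
        fix s assume "s \<in> closed_segment (pathfinish \<gamma> - of_real T) (pathstart \<gamma> - of_real T)"
        then have s: "Re s \<le> R - T"
          by (rule Re_le_on_segment) (auto simp: R_def)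
        have "norm (H s) \<le> B" using s elim by (intro bound) auto
        moreover have "T - R + Re q \<le> norm (s - q)"
          using abs_Re_le_cmod[of "s - q"] s by simp
        ultimately show "norm (?f s) \<le> B / (T - R + Re q)"
          using elim \<open>0 \<le> B\<close> by (auto simp: norm_divide intro!: frac_le)
      qed
      finally show ?case by (simp add: D_def)
    qed
  qed
  then show ?thesis
    by (simp add: LIM_zero_iff)
qed

text \<open>For \<open>p \<noteq> q\<close> the two residues cancel; for \<open>p = q\<close> the integrand has a primitive that vanishes at infinity.\<close>

lemma loop_integral_two_poles:
  assumes \<gamma>: "valid_path \<gamma>" and p: "loop_winds \<gamma> p 1" and q: "loop_winds \<gamma> q 1"
  shows "((\<lambda>T. contour_integral (loop_trunc \<gamma> T) (\<lambda>s. 1 / ((s - p) * (s - q)))) \<longlongrightarrow> 0) at_top"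
proof (cases "p = q")
  case True
  let ?F = "\<lambda>T. 1 / (of_real T + (q - pathfinish \<gamma>)) - 1 / (of_real T + (q - pathstart \<gamma>))"
  have "(?F \<longlongrightarrow> 0 - 0) at_top"
    by (intro tendsto_diff tendsto_divide_0[OF tendsto_const]
        tendsto_add_filterlim_at_infinity'[OF filterlim_of_real_at_infinity tendsto_const])
  moreover have "\<forall>\<^sub>F T in at_top. ?F T = contour_integral (loop_trunc \<gamma> T) (\<lambda>s. 1 / ((s - p) * (s - q)))"
    using eventually_ge_at_top[of 0]
  proof eventually_elim
    case (elim T)
    have "((\<lambda>s. 1 / ((s - p) * (s - q))) has_contour_integral
        (- 1 / (pathfinish (loop_trunc \<gamma> T) - q) - - 1 / (pathstart (loop_trunc \<gamma> T) - q))) (loop_trunc \<gamma> T)"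
    proof (rule contour_integral_primitive)
      show "((\<lambda>s. - 1 / (s - q)) has_field_derivative 1 / ((s - p) * (s - q))) (at s within - {q})"
        if "s \<in> - {q}" for s
        using that True by (auto intro!: derivative_eq_intros)
    qed (use \<gamma> loop_winds_notin[OF q elim] in auto)
    moreover have "1 / (of_real T + (q - w)) = - 1 / (w - of_real T - q)" for w
      using minus_divide_right[of 1 "w - of_real T - q"] by (simp add: algebra_simps)
    ultimately show ?case
      by (simp only: contour_integral_unique pathstart_loop_trunc pathfinish_loop_trunc)
  qed
  ultimately show ?thesis
    by (auto dest: Lim_transform_eventually)
next
  case False
  have int: "(\<lambda>s. 1 / (s - w)) contour_integrable_on loop_trunc \<gamma> T" if "loop_winds \<gamma> w 1" "T \<ge> 0" for w T
    using loop_winds_notin[OF that] \<gamma> by (intro contour_integrable_inversediff) auto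
  have lim: "((\<lambda>T. contour_integral (loop_trunc \<gamma> T) (\<lambda>s. 1 / (s - w))) \<longlongrightarrow> 2 * of_real pi * \<i>) at_top"
    if "loop_winds \<gamma> w 1" for w
    using loop_integral_cauchy[OF \<gamma> _ _ that, of "\<lambda>_. 1" 0 1] by simp
  \<comment> \<open>Partial fractions: each of the two integrals tends to 2 pi i.\<close>
  have "((\<lambda>T. (contour_integral (loop_trunc \<gamma> T) (\<lambda>s. 1 / (s - p)) -
      contour_integral (loop_trunc \<gamma> T) (\<lambda>s. 1 / (s - q))) / (p - q)) \<longlongrightarrow>
      (2 * of_real pi * \<i> - 2 * of_real pi * \<i>) / (p - q)) at_top"
    by (intro tendsto_intros lim p q) (use False in auto)
  moreover have "\<forall>\<^sub>F T in at_top. (contour_integral (loop_trunc \<gamma> T) (\<lambda>s. 1 / (s - p)) -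
      contour_integral (loop_trunc \<gamma> T) (\<lambda>s. 1 / (s - q))) / (p - q) =
      contour_integral (loop_trunc \<gamma> T) (\<lambda>s. 1 / ((s - p) * (s - q)))"
    using eventually_ge_at_top[of 0]
  proof eventually_elim
    case (elim T)
    have "((\<lambda>s. (1 / (s - p) - 1 / (s - q)) / (p - q)) has_contour_integral
       (contour_integral (loop_trunc \<gamma> T) (\<lambda>s. 1 / (s - p)) -
          contour_integral (loop_trunc \<gamma> T) (\<lambda>s. 1 / (s - q))) / (p - q)) (loop_trunc \<gamma> T)"
      using int[OF p elim] int[OF q elim]
      by (intro has_contour_integral_div has_contour_integral_diff has_contour_integral_integral)
    moreover have "(1 / (s - p) - 1 / (s - q)) / (p - q) = 1 / ((s - p) * (s - q))"
      if "s \<in> path_image (loop_trunc \<gamma> T)" for s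
      using that loop_winds_notin[OF p elim] loop_winds_notin[OF q elim] False
      by (subst diff_frac_eq) (auto simp: divide_simps)
    ultimately have "((\<lambda>s. 1 / ((s - p) * (s - q))) has_contour_integral
       (contour_integral (loop_trunc \<gamma> T) (\<lambda>s. 1 / (s - p)) -
          contour_integral (loop_trunc \<gamma> T) (\<lambda>s. 1 / (s - q))) / (p - q)) (loop_trunc \<gamma> T)"
      by (rule has_contour_integral_eq)
    then show ?case by (simp add: contour_integral_unique)
  qed
  ultimately show ?thesis
    by (auto dest: Lim_transform_eventually)
qed

section \<open>Estimates uniform in the pole and in the truncation length\<close>

text \<open>This integrates 1 / |s - p|^2 along a horizontal ray piece of length T at height y above
  a real p, where x is the horizontal offset of its start from p. The primitive is an arctangent,
  hence bounded.\<close>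

lemma has_integral_inverse_square:
  fixes x y T :: real
  assumes "y \<noteq> 0"
  shows "((\<lambda>u. T / ((x - u * T)\<^sup>2 + y\<^sup>2)) has_integral (arctan (x / y) - arctan ((x - T) / y)) / y) {0..1}"
proof -
  have "((\<lambda>u. T / ((x - u * T)\<^sup>2 + y\<^sup>2)) has_integral
      (- arctan ((x - 1 * T) / y) / y - - arctan ((x - 0 * T) / y) / y)) {0..1}"
  proof (rule fundamental_theorem_of_calculus)
    fix u :: real
    have "((\<lambda>u. - arctan ((x - u * T) / y) / y) has_field_derivative T / ((x - u * T)\<^sup>2 + y\<^sup>2)) (at u within {0..1})"
      using assms by (auto intro!: derivative_eq_intros simp: divide_simps power2_eq_square)
    then show "((\<lambda>u. - arctan ((x - u * T) / y) / y) has_vector_derivative T / ((x - u * T)\<^sup>2 + y\<^sup>2)) (at u within {0..1})"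
      by (simp add: has_real_derivative_iff_has_vector_derivative)
  qed auto
  then show ?thesis by (simp add: diff_divide_distrib)
qed

text \<open>
  The bound has to be uniform in \<open>p\<close> and \<open>T\<close>: it dominates the sum over all poles in the limit \<open>T \<rightarrow> \<infinity>\<close>.
\<close>

lemma norm_ray_integral_le:
  assumes a: "Im a \<noteq> 0" and pq: "p \<in> \<real>" "q \<in> \<real>" and T: "T \<ge> 0"
  shows "norm (contour_integral (linepath a (a - of_real T)) (\<lambda>s. 1 / ((s - p) * (s - q)))) \<le> pi / \<bar>Im a\<bar>"
proof -
  obtain x y where x: "p = of_real x" and y: "q = of_real y" using pq by (auto elim!: Reals_cases)
  let ?f = "\<lambda>s. 1 / ((s - p) * (s - q))"
  let ?B = "\<lambda>x u. T / ((Re a - x - u * T)\<^sup>2 + (Im a)\<^sup>2)"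
  have ne: "s \<noteq> p" "s \<noteq> q" if "Im s \<noteq> 0" for s
    using that x y by auto
  have ns: "(norm (s - of_real v))\<^sup>2 = (Re s - v)\<^sup>2 + (Im s)\<^sup>2" for s v
    by (simp add: cmod_power2)
  have B: "(?B v has_integral (arctan ((Re a - v) / Im a) - arctan ((Re a - v - T) / Im a)) / Im a) {0..1}" for v
    using has_integral_inverse_square[OF a, of T "Re a - v"] by simp
  \<comment> \<open>Values of arctan lie between -pi/2 and pi/2, whatever v and T are; this is the
    source of the uniformity.\<close>
  have Ble: "(arctan ((Re a - v) / Im a) - arctan ((Re a - v - T) / Im a)) / Im a \<le> pi / \<bar>Im a\<bar>" for v
  proof -
    have "\<bar>arctan ((Re a - v) / Im a) - arctan ((Re a - v - T) / Im a)\<bar> \<le> pi"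
      using arctan_bounded[of "(Re a - v) / Im a"] arctan_bounded[of "(Re a - v - T) / Im a"] by linarith
    then have "\<bar>arctan ((Re a - v) / Im a) - arctan ((Re a - v - T) / Im a)\<bar> / \<bar>Im a\<bar> \<le> pi / \<bar>Im a\<bar>"
      by (intro divide_right_mono) auto
    then show ?thesis
      by (metis abs_divide abs_le_D1)
  qed
  have imseg: "Im (linepath a (a - of_real T) u) = Im a" "Re (linepath a (a - of_real T) u) = Re a - u * T" for u
    by (auto simp: linepath_def algebra_simps)
  have "continuous_on (closed_segment a (a - of_real T)) ?f"
  proof -
    have "\<forall>s\<in>closed_segment a (a - of_real T). (s - p) * (s - q) \<noteq> 0"
    proof
      fix s assume "s \<in> closed_segment a (a - of_real T)"
      then have "Im s = Im a" by (auto simp: closed_segment_def algebra_simps)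
      then show "(s - p) * (s - q) \<noteq> 0" using ne[of s] a by auto
    qed
    then show ?thesis by (intro continuous_intros)
  qed
  then have int: "?f contour_integrable_on linepath a (a - of_real T)"
    by (rule contour_integrable_continuous_linepath)
  have "((\<lambda>u. ?f (linepath a (a - of_real T) u) * ((a - of_real T) - a)) has_integral
      contour_integral (linepath a (a - of_real T)) ?f) {0..1}"
    by (rule iffD1[OF has_contour_integral_linepath has_contour_integral_integral[OF int]])
  moreover have "((\<lambda>u. (?B x u + ?B y u) / 2) has_integral
     ((arctan ((Re a - x) / Im a) - arctan ((Re a - x - T) / Im a)) / Im a +
      (arctan ((Re a - y) / Im a) - arctan ((Re a - y - T) / Im a)) / Im a) / 2) {0..1}"
    by (intro has_integral_divide has_integral_add B)
  moreover have "norm (?f (linepath a (a - of_real T) u) * ((a - of_real T) - a)) \<le> (?B x u + ?B y u) / 2" for u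
  proof -
    let ?s = "linepath a (a - of_real T) u"
    have pos: "norm (?s - p) > 0" "norm (?s - q) > 0" using ne[of ?s] a by (auto simp: imseg)
    \<comment> \<open>The inequality separates the two poles: the product of inverse distances
      becomes a mean of inverse squares, each with an explicit integral.\<close>
    have amgm: "\<alpha> * \<beta> \<le> (\<alpha>\<^sup>2 + \<beta>\<^sup>2) / 2" for \<alpha> \<beta> :: real
      using sum_squares_bound[of \<alpha> \<beta>] by simp
    have "norm (?f ?s * ((a - of_real T) - a)) = T * ((1 / norm (?s - p)) * (1 / norm (?s - q)))"
      using T by (simp add: norm_mult norm_divide)
    also have "\<dots> \<le> T * (((1 / norm (?s - p))\<^sup>2 + (1 / norm (?s - q))\<^sup>2) / 2)"
      by (intro mult_left_mono amgm T)
    also have "\<dots> = (T / (norm (?s - p))\<^sup>2 + T / (norm (?s - q))\<^sup>2) / 2"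
      by (simp add: power_divide algebra_simps)
    also have "\<dots> = (?B x u + ?B y u) / 2"
      unfolding x y ns imseg by (simp add: algebra_simps)
    finally show ?thesis .
  qed
  ultimately have "norm (contour_integral (linepath a (a - of_real T)) ?f) \<le>
     ((arctan ((Re a - x) / Im a) - arctan ((Re a - x - T) / Im a)) / Im a +
      (arctan ((Re a - y) / Im a) - arctan ((Re a - y - T) / Im a)) / Im a) / 2"
    by (metis (no_types, lifting) has_integral_integrable integral_norm_bound_integral integral_unique)
  also have "\<dots> \<le> (pi / \<bar>Im a\<bar> + pi / \<bar>Im a\<bar>) / 2"
    by (intro divide_right_mono add_mono Ble) auto
  finally show ?thesis by simp
qed

text \<open>The bounds for contour integrals ask for estimates on an open set around the path, so
  half of the distance between K and A is given up to obtain one.\<close>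

lemma separated_neighbourhood:
  fixes K A :: "'a::heine_borel set"
  assumes "compact K" "closed A" "K \<inter> A = {}"
  obtains S \<delta> where "open S" "K \<subseteq> S" "\<delta> > 0" "\<And>s p. s \<in> S \<Longrightarrow> p \<in> A \<Longrightarrow> \<delta> \<le> dist s p"
proof -
  obtain e where e: "e > 0" "\<And>s p. s \<in> K \<Longrightarrow> p \<in> A \<Longrightarrow> e \<le> dist s p"
    using separate_compact_closed[OF assms] by blast
  have "e / 2 \<le> dist s p" if s: "s \<in> (\<Union>x\<in>K. ball x (e / 2))" and p: "p \<in> A" for s p
  proof -
    obtain x where x: "x \<in> K" "dist x s < e / 2" using s by auto
    show ?thesis using e(2)[OF x(1) p] x(2) dist_triangle[of x p s] by linarith
  qed
  then show ?thesis
    using e(1) by (intro that[of "\<Union>x\<in>K. ball x (e / 2)" "e / 2"]) (auto intro!: bexI)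
qed

text \<open>One constant L, depending on the path and S only, bounds the integral of the difference
  by L times its supremum; e / (2 * L) leaves a strict inequality.\<close>

lemma contour_integral_uniform_limit_holomorphic:
  assumes S: "open S" "valid_path g" "path_image g \<subseteq> S"
    and f: "\<And>n. f n holomorphic_on S" and l: "l holomorphic_on S"
    and lim: "uniform_limit S f l sequentially"
  shows "(\<lambda>n. contour_integral g (f n)) \<longlonglongrightarrow> contour_integral g l"
proof (rule tendstoI)
  fix e :: real assume "e > 0"
  obtain L where L: "L > 0"
    "\<And>h B. h holomorphic_on S \<Longrightarrow> (\<And>z. z \<in> S \<Longrightarrow> norm (h z) \<le> B) \<Longrightarrow> norm (contour_integral g h) \<le> L * B"
    using contour_integral_bound_exists[OF S] by blast
  have "\<forall>\<^sub>F n in sequentially. \<forall>s\<in>S. dist (f n s) (l s) < e / (2 * L)"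
    using lim L(1) \<open>e > 0\<close> by (intro uniform_limitD) auto
  then show "\<forall>\<^sub>F n in sequentially. dist (contour_integral g (f n)) (contour_integral g l) < e"
  proof eventually_elim
    case (elim n)
    have int: "h contour_integrable_on g" if "h holomorphic_on S" for h
      using contour_integrable_holomorphic_simple[OF that S] .
    have "norm (contour_integral g (\<lambda>s. f n s - l s)) \<le> L * (e / (2 * L))"
    proof (rule L(2))
      show "(\<lambda>s. f n s - l s) holomorphic_on S" by (intro holomorphic_intros f l)
      show "norm (f n s - l s) \<le> e / (2 * L)" if "s \<in> S" for s
        using elim that by (auto simp: dist_norm less_imp_le)
    qed
    also have "L * (e / (2 * L)) < e" using L(1) \<open>e > 0\<close> by simp
    also have "contour_integral g (\<lambda>s. f n s - l s) = contour_integral g (f n) - contour_integral g l"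
      by (intro contour_integral_diff int f l)
    finally show ?case by (simp add: dist_norm)
  qed
qed

text \<open>The rays are controlled by \<open>norm_ray_integral_le\<close>, as their heights are
  nonzero. The finite part is compact and keeps a positive distance \<delta> from all of A, so 1 /
  \<delta>^2 bounds the integrand there for every p.\<close>

lemma loop_integral_bounded:
  assumes \<gamma>: "valid_path \<gamma>" "Im (pathstart \<gamma>) \<noteq> 0" "Im (pathfinish \<gamma>) \<noteq> 0"
    and A: "closed A" "A \<subseteq> \<real>" "path_image \<gamma> \<inter> A = {}" and q: "q \<in> A"
  obtains M where "\<And>p T. p \<in> A \<Longrightarrow> T \<ge> 0 \<Longrightarrow>
     norm (contour_integral (loop_trunc \<gamma> T) (\<lambda>s. 1 / ((s - p) * (s - q)))) \<le> M"
proof -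
  obtain S \<delta> where S: "open S" "path_image \<gamma> \<subseteq> S" and \<delta>: "\<delta> > 0"
    "\<And>s p. s \<in> S \<Longrightarrow> p \<in> A \<Longrightarrow> \<delta> \<le> dist s p"
    using separated_neighbourhood[OF compact_path_image[OF valid_path_imp_path[OF \<gamma>(1)]] A(1,3)] by blast
  obtain L where L: "L > 0"
    "\<And>h B. h holomorphic_on S \<Longrightarrow> (\<And>z. z \<in> S \<Longrightarrow> norm (h z) \<le> B) \<Longrightarrow> norm (contour_integral \<gamma> h) \<le> L * B"
    using contour_integral_bound_exists[OF S(1) \<gamma>(1) S(2)] by blast
  let ?a = "pathstart \<gamma>" and ?e = "pathfinish \<gamma>"
  have "norm (contour_integral (loop_trunc \<gamma> T) (\<lambda>s. 1 / ((s - p) * (s - q)))) \<le>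
          pi / \<bar>Im ?a\<bar> + (L * (1 / (\<delta> * \<delta>)) + pi / \<bar>Im ?e\<bar>)"
    if p: "p \<in> A" and T: "T \<ge> 0" for p T
  proof -
    let ?f = "\<lambda>s. 1 / ((s - p) * (s - q))"
    have pq: "p \<in> \<real>" "q \<in> \<real>" using p q A by auto
    have ray: "?f contour_integrable_on linepath w (w - of_real T)" if w: "Im w \<noteq> 0" for w
    proof -
      have "\<forall>s\<in>closed_segment w (w - of_real T). (s - p) * (s - q) \<noteq> 0"
      proof
        fix s assume "s \<in> closed_segment w (w - of_real T)"
        then have "Im s = Im w" by (auto simp: closed_segment_def algebra_simps)
        then show "(s - p) * (s - q) \<noteq> 0" using w pq by (auto simp: complex_is_Real_iff)
      qed
      then show ?thesis
        by (intro contour_integrable_continuous_linepath continuous_intros)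
    qed
    have ne: "s \<noteq> p" "s \<noteq> q" if "s \<in> S" for s
      using \<delta>(1) \<delta>(2)[OF that p] \<delta>(2)[OF that q] by auto
    then have hol: "?f holomorphic_on S"
      by (intro holomorphic_intros) auto
    then have int: "?f contour_integrable_on \<gamma>"
      using contour_integrable_holomorphic_simple S \<gamma>(1) by blast
    \<comment> \<open>The incoming ray is reversed, because the ray estimate is stated for leftward
      segments.\<close>
    have rev: "?f contour_integrable_on linepath (?a - of_real T) ?a"
      "contour_integral (linepath (?a - of_real T) ?a) ?f = - contour_integral (linepath ?a (?a - of_real T)) ?f"
      using ray[OF \<gamma>(2)] contour_integrable_reversepath[of "linepath ?a (?a - of_real T)"]
        contour_integral_reversepath[of "linepath ?a (?a - of_real T)"] by auto
    have split: "contour_integral (loop_trunc \<gamma> T) ?f = - contour_integral (linepath ?a (?a - of_real T)) ?f +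
        (contour_integral \<gamma> ?f + contour_integral (linepath ?e (?e - of_real T)) ?f)"
      unfolding loop_trunc_def rev(2)[symmetric]
      using \<gamma>(1) rev(1) int ray[OF \<gamma>(3)] by simp
    show ?thesis unfolding split
    proof (intro norm_triangle_mono)
      show "norm (- contour_integral (linepath ?a (?a - of_real T)) ?f) \<le> pi / \<bar>Im ?a\<bar>"
        "norm (contour_integral (linepath ?e (?e - of_real T)) ?f) \<le> pi / \<bar>Im ?e\<bar>"
        using norm_ray_integral_le[OF _ pq T] \<gamma> by auto
      show "norm (contour_integral \<gamma> ?f) \<le> L * (1 / (\<delta> * \<delta>))"
      proof (rule L(2)[OF hol])
        fix s assume s: "s \<in> S"
        have "\<delta> * \<delta> \<le> norm (s - p) * norm (s - q)"
          using \<delta>(1) \<delta>(2)[OF s p] \<delta>(2)[OF s q] by (intro mult_mono) (auto simp: dist_norm)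
        then show "norm (?f s) \<le> 1 / (\<delta> * \<delta>)"
          using \<delta>(1) by (simp add: norm_divide norm_mult frac_le)
      qed
    qed
  qed
  then show ?thesis by (rule that)
qed

section \<open>Integrating the pole series\<close>

text \<open>A compact path off the closed set of poles stays away from it, so the series divided by
  s - q converges uniformly near the path.\<close>

lemma sums_loop_integral_pole_series:
  assumes c: "c > 0" and \<gamma>: "valid_path \<gamma>"
    and av: "path_image \<gamma> \<inter> insert q half_poles = {}"
  shows "(\<lambda>k. of_real ((- c) ^ k / fact k) / 2 *
            contour_integral \<gamma> (\<lambda>s. 1 / ((s - - (of_nat k / 2)) * (s - q)))) sums
          contour_integral \<gamma> (\<lambda>s. pole_series c s / (s - q))"
proof -
  let ?A = "insert q half_poles"
  have cl: "closed ?A" using closed_half_poles by (rule closed_insert)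
  obtain S \<delta> where S: "open S" "path_image \<gamma> \<subseteq> S" and \<delta>: "\<delta> > 0"
    "\<And>s p. s \<in> S \<Longrightarrow> p \<in> ?A \<Longrightarrow> \<delta> \<le> dist s p"
    using separated_neighbourhood[OF compact_path_image[OF valid_path_imp_path[OF \<gamma>]] cl av] by blast
  have av: "s \<notin> ?A" if "s \<in> S" for s
    using \<delta>(1) \<delta>(2)[OF that, of s] by auto
  define a where "a = (\<lambda>k. complex_of_real ((- c) ^ k / fact k))"
  have ne: "s - - (of_nat k / 2) \<noteq> 0" "s - q \<noteq> 0" if "s \<in> S" for s k
    using av[OF that] half_polesI[of k] by (auto simp only: right_minus_eq)
  \<comment> \<open>Writing 2s + k as 2 (s - p) with p = -k/2 brings each term into the shape of
    \<open>loop_integral_two_poles\<close>.\<close>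
  have term_eq: "a k / (2 * s + of_nat k) / (s - q) = a k / 2 * (1 / ((s - - (of_nat k / 2)) * (s - q)))" for k s
  proof -
    have "2 * s + of_nat k = 2 * (s - - (of_nat k / 2))" by simp
    then show ?thesis by (simp only: divide_divide_eq_left times_divide_times_eq mult.assoc mult_1_right)
  qed
  have hol: "(\<lambda>s. a k / (2 * s + of_nat k) / (s - q)) holomorphic_on S" for k
    unfolding term_eq by (intro holomorphic_intros) (use ne in auto)
  have "uniform_limit S (\<lambda>n s. \<Sum>k<n. a k / (2 * s + of_nat k)) (pole_series c) sequentially"
    unfolding a_def by (rule uniform_limit_pole_series[OF c \<delta>(1)]) (use \<delta>(2) in auto)
  then have "uniform_limit S (\<lambda>n s. (\<Sum>k<n. a k / (2 * s + of_nat k)) / (s - q))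
      (\<lambda>s. pole_series c s / (s - q)) sequentially"
  proof (intro uniform_limitI)
    fix e :: real assume lim: "uniform_limit S (\<lambda>n s. \<Sum>k<n. a k / (2 * s + of_nat k)) (pole_series c) sequentially"
      and e: "e > 0"
    have "\<forall>\<^sub>F n in sequentially. \<forall>s\<in>S. dist (\<Sum>k<n. a k / (2 * s + of_nat k)) (pole_series c s) < e * \<delta>"
      using lim e \<delta>(1) by (intro uniform_limitD) auto
    then show "\<forall>\<^sub>F n in sequentially. \<forall>s\<in>S. dist ((\<Sum>k<n. a k / (2 * s + of_nat k)) / (s - q)) (pole_series c s / (s - q)) < e"
    proof eventually_elim
      case (elim n)
      show ?case
      proof
        fix s assume s: "s \<in> S"
        have "\<delta> \<le> norm (s - q)" using \<delta>(2)[OF s, of q] by (simp add: dist_norm)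
        then have "e * \<delta> \<le> e * norm (s - q)" using e by simp
        moreover have "norm ((\<Sum>k<n. a k / (2 * s + of_nat k)) - pole_series c s) < e * \<delta>"
          using elim s by (simp add: dist_norm)
        ultimately show "dist ((\<Sum>k<n. a k / (2 * s + of_nat k)) / (s - q)) (pole_series c s / (s - q)) < e"
          using ne(2)[OF s] by (simp add: dist_norm norm_divide divide_less_eq flip: diff_divide_distrib)
      qed
    qed
  qed
  then have lim: "uniform_limit S (\<lambda>n s. \<Sum>k<n. a k / (2 * s + of_nat k) / (s - q))
      (\<lambda>s. pole_series c s / (s - q)) sequentially"
    by (simp add: sum_divide_distrib)
  have "(\<lambda>n. contour_integral \<gamma> (\<lambda>s. \<Sum>k<n. a k / (2 * s + of_nat k) / (s - q))) \<longlonglongrightarrow>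
      contour_integral \<gamma> (\<lambda>s. pole_series c s / (s - q))"
  proof (rule contour_integral_uniform_limit_holomorphic[OF S(1) \<gamma> S(2) _ _ lim])
    show "(\<lambda>s. \<Sum>k<n. a k / (2 * s + of_nat k) / (s - q)) holomorphic_on S" for n
      by (intro holomorphic_on_sum hol)
    show "(\<lambda>s. pole_series c s / (s - q)) holomorphic_on S"
      using av ne(2) by (intro holomorphic_intros holomorphic_on_subset[OF holomorphic_pole_series[OF c]]) auto
  qed
  moreover have "contour_integral \<gamma> (\<lambda>s. \<Sum>k<n. a k / (2 * s + of_nat k) / (s - q)) =
      (\<Sum>k<n. a k / 2 * contour_integral \<gamma> (\<lambda>s. 1 / ((s - - (of_nat k / 2)) * (s - q))))" for n
  proof (rule trans[OF contour_integral_sum])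
    show int: "(\<lambda>s. a k / (2 * s + of_nat k) / (s - q)) contour_integrable_on \<gamma>" for k
      using contour_integrable_holomorphic_simple[OF hol S(1) \<gamma> S(2)] .
    have "(\<lambda>s. 1 / ((s - - (of_nat k / 2)) * (s - q))) contour_integrable_on \<gamma>" for k
      by (rule contour_integrable_holomorphic_simple[OF _ S(1) \<gamma> S(2)], intro holomorphic_intros)
         (use ne in auto)
    then show "(\<Sum>k<n. contour_integral \<gamma> (\<lambda>s. a k / (2 * s + of_nat k) / (s - q))) =
      (\<Sum>k<n. a k / 2 * contour_integral \<gamma> (\<lambda>s. 1 / ((s - - (of_nat k / 2)) * (s - q))))"
      unfolding term_eq by (intro sum.cong refl contour_integral_lmul)
  qed simp
  ultimately show ?thesis
    unfolding sums_def a_def by simp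
qed

lemma half_poles_real: "half_poles \<subseteq> \<real>"
proof
  fix s assume "s \<in> half_poles"
  then obtain k where "2 * s = - of_nat k" by (auto elim: nonpos_Ints_cases')
  then have "s = of_real (- (real k / 2))" by (simp add: field_simps)
  then show "s \<in> \<real>" by (metis Reals_of_real)
qed

text \<open>Tannery's theorem exchanges the sum over k with the limit in T: each term tends to 0 by
  \<open>loop_integral_two_poles\<close>, and \<open>loop_integral_bounded\<close> supplies a
  summable majorant free of T.\<close>

lemma loop_integral_pole_series:
  assumes c: "c > 0" and \<gamma>: "valid_path \<gamma>" and w: "\<And>p. p \<in> half_poles \<Longrightarrow> loop_winds \<gamma> p 1"
    and q: "q \<in> \<real>" "loop_winds \<gamma> q 1"
  shows "((\<lambda>T. contour_integral (loop_trunc \<gamma> T) (\<lambda>s. pole_series c s / (s - q))) \<longlongrightarrow> 0) at_top"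
proof -
  let ?A = "insert q half_poles"
  have av: "path_image (loop_trunc \<gamma> T) \<inter> ?A = {}" if "T \<ge> 0" for T
    using loop_winds_notin[OF w that] loop_winds_notin[OF q(2) that] by auto
  \<comment> \<open>A ray on the real axis would run into a pole.\<close>
  have Im: "Im e \<noteq> 0" if e: "\<And>T. T \<ge> 0 \<Longrightarrow> e - of_real T \<in> path_image (loop_trunc \<gamma> T)" for e
  proof
    assume "Im e = 0"
    \<comment> \<open>With T = Re e + k/2 the point e - T is the pole -k/2; k is taken so large that
      T is nonnegative.\<close>
    obtain k :: nat where k: "real k \<ge> - 2 * Re e" using real_arch_simple by blast
    then have T: "Re e + real k / 2 \<ge> 0" by simp
    have "e - of_real (Re e + real k / 2) = - (of_nat k / 2)"
      using \<open>Im e = 0\<close> by (simp add: complex_eq_iff)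
    then show False using e[OF T] av[OF T] half_polesI[of k] by auto
  qed
  have "Im (pathstart \<gamma>) \<noteq> 0" "Im (pathfinish \<gamma>) \<noteq> 0"
    by (rule Im, simp add: path_image_loop_trunc)+
  moreover have "path_image \<gamma> \<inter> ?A = {}"
    using av[of 0] by (auto simp: path_image_loop_trunc)
  moreover have "closed ?A" "?A \<subseteq> \<real>"
    using closed_half_poles half_poles_real q by auto
  ultimately obtain M where M: "\<And>p T. p \<in> ?A \<Longrightarrow> T \<ge> 0 \<Longrightarrow>
     norm (contour_integral (loop_trunc \<gamma> T) (\<lambda>s. 1 / ((s - p) * (s - q)))) \<le> M"
    using loop_integral_bounded[of \<gamma> ?A q] \<gamma> by blast
  let ?t = "\<lambda>k T. of_real ((- c) ^ k / fact k) / 2 *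
      contour_integral (loop_trunc \<gamma> T) (\<lambda>s. 1 / ((s - - (of_nat k / 2)) * (s - q)))"
  have "((\<lambda>T. \<Sum>k. ?t k T) \<longlongrightarrow> (\<Sum>k::nat. 0)) at_top"
  proof (rule tannerys_theorem[THEN conjunct2, THEN conjunct2])
    show "((\<lambda>T. ?t k T) \<longlongrightarrow> 0) at_top" for k
      by (intro tendsto_mult_right_zero loop_integral_two_poles \<gamma> w q half_polesI)
    show "summable (\<lambda>k. c ^ k / fact k / 1 * (M / 2))"
      by (intro summable_mult2 summable_exp_coeffs)
    have "\<forall>\<^sub>F T in at_top. T \<ge> (0::real)" by (rule eventually_ge_at_top)
    from eventually_prodI[OF always_eventually[of "\<lambda>_. True"] this]
    have "\<forall>\<^sub>F (k::nat, T) in at_top \<times>\<^sub>F at_top. T \<ge> (0::real)"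
      by (simp add: case_prod_unfold)
    then show "\<forall>\<^sub>F (k, T) in at_top \<times>\<^sub>F at_top. norm (?t k T) \<le> c ^ k / fact k / 1 * (M / 2)"
    proof eventually_elim
      case (elim kT)
      obtain k T where kT: "kT = (k, T)" by fastforce
      have "c ^ k / fact k * norm (contour_integral (loop_trunc \<gamma> T) (\<lambda>s. 1 / ((s - - (of_nat k / 2)) * (s - q)))) \<le>
          c ^ k / fact k * M"
        using elim kT c half_polesI[of k] by (intro mult_left_mono M) auto
      from divide_right_mono[OF this, of 2] show ?case
        using c by (simp add: kT norm_mult norm_divide norm_power)
    qed
  qed simp
  then have lim: "((\<lambda>T. \<Sum>k. ?t k T) \<longlongrightarrow> 0) at_top" by simp
  show ?thesis
  proof (rule Lim_transform_eventually[OF lim])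
    show "\<forall>\<^sub>F T in at_top. (\<Sum>k. ?t k T) =
        contour_integral (loop_trunc \<gamma> T) (\<lambda>s. pole_series c s / (s - q))"
      using eventually_ge_at_top[of 0]
    proof eventually_elim
      case (elim T)
      show ?case
        using sums_loop_integral_pole_series[OF c valid_path_loop_trunc[OF \<gamma>] av[OF elim]]
        by (simp add: sums_iff)
    qed
  qed
qed

subsection \<open>The value of the G-function\<close>

text \<open>Even k gives a pole of Gamma s, the parameter at index 1; odd k gives a pole of Gamma
  (1/2 + s), index 2.\<close>

lemma half_poles_subset_meijer_poles: "half_poles \<subseteq> meijer_poles_b 3 [b, 0, 1/2]"
proof
  fix s assume "s \<in> half_poles"
  then obtain k where k: "2 * s = - of_nat k" by (auto elim: nonpos_Ints_cases')
  show "s \<in> meijer_poles_b 3 [b, 0, 1/2]"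
  proof (cases "even k")
    case True
    then obtain j where "k = 2 * j" by (elim evenE)
    with k have "s = - of_nat j" by simp
    then have "[b, 0, 1/2] ! 1 + s \<in> \<int>\<^sub>\<le>\<^sub>0" by simp
    then show ?thesis unfolding meijer_poles_b_def by (intro CollectI exI[of _ 1]) simp
  next
    case False
    then obtain j where "k = 2 * j + 1" by (elim oddE)
    then have "2 * (1/2 + s) = 2 * (- of_nat j)"
      using k by (simp add: distrib_left)
    then have "1/2 + s = - of_nat j" by (simp only: mult_cancel_left) simp
    then have "[b, 0, 1/2] ! 2 + s \<in> \<int>\<^sub>\<le>\<^sub>0" by simp
    then show ?thesis unfolding meijer_poles_b_def by (intro CollectI exI[of _ 2]) simp
  qed
qed

text \<open>An identity off the poles suffices, since the truncated loops avoid them; there Gamma (b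
  + s) is nonzero and cancels. The form \<open>s - - b\<close> matches the lemmas on loops with q =
  -b.\<close>

lemma meijer_integrand_eq:
  assumes c: "c > 0" and s: "s \<notin> meijer_poles_b 3 [b, 0, 1/2]"
  shows "meijer_integrand 3 0 [b + 1] [b, 0, 1/2] (of_real (c\<^sup>2 / 4)) s =
    2 * of_real (sqrt pi) * (pole_series c s / (s - - b) + (inc_gamma c s / 2) / (s - - b))"
proof -
  have bs: "b + s \<notin> \<int>\<^sub>\<le>\<^sub>0" "s \<notin> \<int>\<^sub>\<le>\<^sub>0" "s + 1/2 \<notin> \<int>\<^sub>\<le>\<^sub>0"
    using s unfolding meijer_poles_b_def by (auto simp: numeral_3_eq_3 less_Suc_eq add.commute)
  have s2: "2 * s \<notin> \<int>\<^sub>\<le>\<^sub>0"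
    using s half_poles_subset_meijer_poles by blast
  have "s - - b = b + s" by simp
  have g: "Gamma (b + 1 + s) = (b + s) * Gamma (b + s)"
    using Gamma_plus1[of "b + s"] bs(1) by (simp add: add_ac)
  have "Gamma (b + s) \<noteq> 0" using bs(1) by (simp add: Gamma_eq_zero_iff)
  \<comment> \<open>The factor 2^(1-2s) of the duplication formula meets 4^s from (c^2/4)^(-s),
    leaving the constant 2.\<close>
  have pw: "exp ((1 - 2 * s) * of_real (ln 2)) * complex_of_real (c\<^sup>2 / 4) powr (- s) =
      2 * of_real c powr (- 2 * s)"
  proof -
    have "ln (c\<^sup>2 / 4) = 2 * ln c - 2 * ln 2"
      using c ln_realpow[of 2 2] by (simp add: ln_div ln_realpow)
    then have "complex_of_real (c\<^sup>2 / 4) powr (- s) = exp (- s * of_real (2 * ln c - 2 * ln 2))"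
      using c by (simp add: powr_def Ln_of_real del: of_real_divide of_real_power)
    moreover have "of_real c powr (- 2 * s) = exp (- 2 * s * of_real (ln c))"
      using c by (simp add: powr_def Ln_of_real)
    moreover have e2: "exp (of_real (ln 2)) = (2::complex)"
      by (simp only: exp_of_real) simp
    have "2 * exp (- 2 * s * of_real (ln c)) = exp (of_real (ln 2) + - 2 * s * of_real (ln c))"
      unfolding exp_add e2 ..
    ultimately show ?thesis
      by (simp add: algebra_simps flip: exp_add)
  qed
  have "meijer_integrand 3 0 [b + 1] [b, 0, 1/2] (of_real (c\<^sup>2 / 4)) s =
      Gamma (b + s) * (Gamma s * Gamma (s + 1/2)) / Gamma (b + 1 + s) * complex_of_real (c\<^sup>2 / 4) powr (- s)"
    by (simp add: meijer_integrand_def numeral_3_eq_3 add_ac mult_ac del: of_real_divide)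
  also have "\<dots> = (Gamma s * Gamma (s + 1/2)) / (b + s) * complex_of_real (c\<^sup>2 / 4) powr (- s)"
    unfolding g using \<open>Gamma (b + s) \<noteq> 0\<close> by simp
  also have "\<dots> = of_real (sqrt pi) * Gamma (2 * s) / (b + s) *
      (exp ((1 - 2 * s) * of_real (ln 2)) * complex_of_real (c\<^sup>2 / 4) powr (- s))"
    unfolding Gamma_legendre_duplication[OF bs(2,3)] by simp
  also have "\<dots> = 2 * of_real (sqrt pi) * (Gamma (2 * s) * of_real c powr (- 2 * s)) / (b + s)"
    unfolding pw by simp
  also have "\<dots> = 2 * of_real (sqrt pi) * (pole_series c s / (s - - b) + (inc_gamma c s / 2) / (s - - b))"
    unfolding Gamma_double[OF c s2] \<open>s - - b = b + s\<close>
    by (simp only: add_divide_distrib[symmetric] times_divide_eq_right)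
  finally show ?thesis .
qed

text \<open>The loop is arbitrary, so this settles both existence and uniqueness in the definite
  description of \<open>meijer_G\<close>. With n = 0 the list \<open>as\<close> imposes no condition
  on the loop.\<close>

lemma has_loop_integral_meijer:
  assumes c: "c > 0" and loop: "meijer_loop 3 0 as [of_real \<beta>, 0, 1/2] \<gamma>"
  shows "has_loop_integral (meijer_integrand 3 0 [of_real \<beta> + 1] [of_real \<beta>, 0, 1/2] (of_real (c\<^sup>2 / 4)))
           (2 * of_real pi * \<i> * (of_real (sqrt pi) * inc_gamma c (- of_real \<beta>))) \<gamma>"
proof -
  let ?P = "meijer_poles_b 3 [of_real \<beta>, 0, 1/2]" and ?q = "- complex_of_real \<beta>"
  let ?f = "meijer_integrand 3 0 [of_real \<beta> + 1] [of_real \<beta>, 0, 1/2] (of_real (c\<^sup>2 / 4))"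
  have \<gamma>: "valid_path \<gamma>" and w: "\<And>w. w \<in> ?P \<Longrightarrow> loop_winds \<gamma> w 1"
    using loop by (auto simp: meijer_loop_def)
  have "[of_real \<beta>, 0, 1/2] ! 0 + ?q \<in> \<int>\<^sub>\<le>\<^sub>0" by simp
  then have qP: "?q \<in> ?P" unfolding meijer_poles_b_def by (intro CollectI exI[of _ 0]) simp
  have q: "?q \<in> \<real>" "loop_winds \<gamma> ?q 1" using w[OF qP] by auto
  have hw: "loop_winds \<gamma> p 1" if "p \<in> half_poles" for p
    using w half_poles_subset_meijer_poles that by blast
  let ?p = "\<lambda>s. pole_series c s / (s - ?q)" and ?h = "\<lambda>s. (inc_gamma c s / 2) / (s - ?q)"
  let ?ci = "\<lambda>T. contour_integral (loop_trunc \<gamma> T)"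
  have "((\<lambda>T. ?ci T ?h) \<longlongrightarrow> 2 * of_real pi * \<i> * (inc_gamma c ?q / 2)) at_top"
    by (rule loop_integral_cauchy[where H = "\<lambda>s. inc_gamma c s / 2" and r = "-1" and B = 1, OF \<gamma> _ _ q(2)])
       (auto simp: norm_divide intro!: holomorphic_intros holomorphic_inc_gamma[OF c]
          order_trans[OF norm_inc_gamma_le_1[OF c]])
  \<comment> \<open>The pole part contributes 0, and the factor 2 cancels the half in front of
    \<open>inc_gamma\<close>.\<close>
  from tendsto_mult_left[OF tendsto_add[OF loop_integral_pole_series[OF c \<gamma> hw q] this], of "2 * of_real (sqrt pi)"]
  have lim: "((\<lambda>T. 2 * of_real (sqrt pi) * (?ci T ?p + ?ci T ?h)) \<longlongrightarrow>
      2 * of_real pi * \<i> * (of_real (sqrt pi) * inc_gamma c ?q)) at_top"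
    by (simp add: mult_ac)
  show ?thesis unfolding has_loop_integral_def
  proof (rule Lim_transform_eventually[OF lim])
    show "\<forall>\<^sub>F T in at_top. 2 * of_real (sqrt pi) * (?ci T ?p + ?ci T ?h) = ?ci T ?f"
      using eventually_ge_at_top[of 0]
    proof eventually_elim
      case (elim T)
      note ni = loop_winds_notin[OF _ elim]
      have sub: "path_image (loop_trunc \<gamma> T) \<subseteq> - insert ?q half_poles"
        using ni[OF hw] ni[OF q(2)] by auto
      have op: "open (- insert ?q half_poles)"
        using closed_half_poles by (intro open_Compl closed_insert)
      have ne: "\<And>s. s \<in> - insert ?q half_poles \<Longrightarrow> s - ?q \<noteq> 0"
        by (auto simp only: right_minus_eq)
      have "?p holomorphic_on - insert ?q half_poles"
        by (rule holomorphic_on_divide[OF holomorphic_on_subset[OF holomorphic_pole_series[OF c]] _ ne])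
           (auto intro!: holomorphic_intros)
      moreover have "?h holomorphic_on - insert ?q half_poles"
        by (rule holomorphic_on_divide[OF _ _ ne])
           (auto intro!: holomorphic_intros holomorphic_on_subset[OF holomorphic_inc_gamma[OF c]])
      ultimately have "?p contour_integrable_on loop_trunc \<gamma> T" "?h contour_integrable_on loop_trunc \<gamma> T"
        using contour_integrable_holomorphic_simple[OF _ op valid_path_loop_trunc[OF \<gamma>] sub] by auto
      then have "((\<lambda>s. 2 * of_real (sqrt pi) * (?p s + ?h s)) has_contour_integral
          2 * of_real (sqrt pi) * (?ci T ?p + ?ci T ?h)) (loop_trunc \<gamma> T)"
        by (intro has_contour_integral_lmul has_contour_integral_add has_contour_integral_integral)
      moreover have "2 * of_real (sqrt pi) * (?p s + ?h s) = ?f s" if "s \<in> path_image (loop_trunc \<gamma> T)" for s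
        by (rule meijer_integrand_eq[OF c, symmetric]) (use that ni[OF w, of s] in blast)
      ultimately have "(?f has_contour_integral 2 * of_real (sqrt pi) * (?ci T ?p + ?ci T ?h)) (loop_trunc \<gamma> T)"
        by (rule has_contour_integral_eq)
      then show ?case by (simp add: contour_integral_unique)
    qed
  qed
qed

text \<open>As \<beta> \<ge> 0, all poles are real and at most 0. The segment lies to their right,
  and closing the truncated loop gives a counterclockwise rectangle that contains w once its left
  edge 1 - T is less than Re w.\<close>

lemma ex_meijer_loop:
  assumes "\<beta> \<ge> 0"
  shows "meijer_loop 3 0 as [of_real \<beta>, 0, 1/2] (linepath (1 - \<i>) (1 + \<i>))"
proof -
  let ?\<gamma> = "linepath (1 - \<i>) (1 + \<i>)"
  have "loop_winds ?\<gamma> w 1" if w: "w \<in> meijer_poles_b 3 [of_real \<beta>, 0, 1/2]" for w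
  proof -
    obtain j where j: "j < 3" "[of_real \<beta>, 0, 1/2] ! j + w \<in> \<int>\<^sub>\<le>\<^sub>0"
      using w by (auto simp: meijer_poles_b_def)
    then obtain k where k: "[of_real \<beta>, 0, 1/2] ! j + w = - of_nat k" by (elim nonpos_Ints_cases')
    have w: "Re w \<le> 0" "Im w = 0"
      using arg_cong[OF k, of Re] arg_cong[OF k, of Im] j(1) assms
      by (auto simp: numeral_3_eq_3 less_Suc_eq)
    show ?thesis unfolding loop_winds_def
      using eventually_gt_at_top[of "1 - Re w"]
    proof eventually_elim
      case (elim T)
      let ?a = "1 - \<i> - of_real T" and ?b = "1 + \<i> - of_real T"
      let ?r = "rectpath ?a (1 + \<i>)"
      have r: "?r = linepath ?a (1 - \<i>) +++ ?\<gamma> +++ linepath (1 + \<i>) ?b +++ linepath ?b ?a"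
      proof -
        have "Complex 1 (-1) = 1 - \<i>" "Complex (1 - T) 1 = ?b"
          by (simp_all add: complex_eq_iff)
        then show ?thesis by (simp add: rectpath_def Let_def)
      qed
      \<comment> \<open>These are the four sides of the rectangle in the same order, only bracketed
        differently; additivity of winding numbers bridges the gap.\<close>
      have l: "loop_closed ?\<gamma> T = (linepath ?a (1 - \<i>) +++ ?\<gamma> +++ linepath (1 + \<i>) ?b) +++ linepath ?b ?a"
        by (simp add: loop_closed_def loop_trunc_def)
      have box: "w \<in> box ?a (1 + \<i>)"
        using w elim by (simp add: in_box_complex_iff)
      then have "w \<notin> path_image ?r"
        using w elim by (subst path_image_rectpath_cbox_minus_box) auto
      then have ni: "w \<notin> path_image (linepath ?a (1 - \<i>))" "w \<notin> path_image ?\<gamma>"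
        "w \<notin> path_image (linepath (1 + \<i>) ?b)" "w \<notin> path_image (linepath ?b ?a)"
        unfolding r by (auto simp: path_image_join)
      then have "winding_number (loop_closed ?\<gamma> T) w = winding_number ?r w"
        unfolding l r by (simp add: winding_number_join path_image_join del: path_image_linepath)
      with ni winding_number_rectpath[OF box] show ?case
        by (auto simp: l path_image_join)
    qed
  qed
  then show ?thesis by (auto simp: meijer_loop_def meijer_poles_a_def)
qed

text \<open>The explicit loop of \<open>ex_meijer_loop\<close> gives existence; uniqueness holds
  because every admissible loop yields the same limit.\<close>

lemma meijer_G_value:
  assumes c: "c > 0" and "\<beta> \<ge> 0"
  shows "meijer_G 3 0 [of_real \<beta> + 1] [of_real \<beta>, 0, 1/2] (of_real (c\<^sup>2 / 4)) =
           of_real (sqrt pi) * inc_gamma c (- of_real \<beta>)"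
  unfolding meijer_G_def
proof (rule the_equality)
  let ?f = "meijer_integrand 3 0 [of_real \<beta> + 1] [of_real \<beta>, 0, 1/2] (of_real (c\<^sup>2 / 4))"
  let ?v = "of_real (sqrt pi) * inc_gamma c (- of_real \<beta>)"
  show "\<exists>\<gamma> I. meijer_loop 3 0 [of_real \<beta> + 1] [of_real \<beta>, 0, 1/2] \<gamma> \<and> has_loop_integral ?f I \<gamma> \<and>
      ?v = 1 / (2 * of_real pi * \<i>) * I"
    using ex_meijer_loop[OF assms(2)] has_loop_integral_meijer[OF c ex_meijer_loop[OF assms(2)]]
    by (intro exI conjI) (assumption | simp)+
  fix g assume "\<exists>\<gamma> I. meijer_loop 3 0 [of_real \<beta> + 1] [of_real \<beta>, 0, 1/2] \<gamma> \<and> has_loop_integral ?f I \<gamma> \<and>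
      g = 1 / (2 * of_real pi * \<i>) * I"
  then obtain \<gamma> I where *: "meijer_loop 3 0 [of_real \<beta> + 1] [of_real \<beta>, 0, 1/2] \<gamma>"
    "has_loop_integral ?f I \<gamma>" "g = 1 / (2 * of_real pi * \<i>) * I" by blast
  have "I = 2 * of_real pi * \<i> * ?v"
    using has_loop_integral_meijer[OF c *(1)] *(2) unfolding has_loop_integral_def
    by (rule tendsto_unique[OF trivial_limit_at_top_linorder, rotated])
  then show "g = ?v" using *(3) by simp
qed

subsection \<open>The series expansion\<close>

text \<open>At s = - \<beta> the kernel is t powr (\<beta> - 1) times the damping factor. With y = d
  t, the factor y^r from the exponential series raises the exponent from \<nu> to \<nu> + r, which
  is \<beta> - 1 for \<beta> = \<nu> + r + 1.\<close>

lemma I2_sums: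
  fixes z d \<nu> :: real
  assumes z: "z > 0" and d: "d > 0" and \<nu>: "\<nu> \<ge> 0"
  shows "(\<lambda>r. of_real ((- d) ^ r / fact r) * inc_gamma (z / sqrt d) (- of_real (\<nu> + real r + 1)))
           sums of_real (I2 z d \<nu> / d powr (1 + \<nu>))"
proof -
  define c where "c = z / sqrt d"
  have c: "c > 0" using z d by (simp add: c_def)
  define E where "E = (\<lambda>\<beta> t. Re (inc_kernel c (of_real (- \<beta>)) t))"
  have E: "E \<beta> t = (if t \<le> 0 then 0 else t powr (\<beta> - 1) * exp (- c * t powr (-1/2)))" for \<beta> t
    unfolding E_def inc_kernel_of_real by (simp add: powr_def algebra_simps flip: exp_add)
  have Econt: "continuous_on {0..1} (E \<beta>)" for \<beta>
    unfolding E_def by (intro continuous_intros continuous_on_inc_kernel c)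
  \<comment> \<open>This is the integrand of \<open>I2\<close> without exp (- y). Expressed through
    \<open>E\<close> it is visibly continuous up to 0, as termwise integration demands.\<close>
  define h where "h = (\<lambda>y. d powr \<nu> * E (\<nu> + 1) (y / d))"
  have "continuous_on {0..d} h"
    unfolding h_def using d
    by (intro continuous_intros continuous_on_compose2[OF Econt]) auto
  note sums = sums_integral_exp_minus[OF this]
  have zc: "z * (d * t) powr (-1/2) = c * t powr (-1/2)" if "t > 0" for t
    using that d by (simp add: c_def powr_mult powr_minus powr_half_sqrt divide_simps)
  have "integral {0..d} (\<lambda>t. h t * exp (- t)) = I2 z d \<nu>"
    unfolding I2_def
  proof (rule integral_spike[of "{0}"])
    fix y assume "y \<in> {0..d} - {0}"
    then have y: "y > 0" "y / d > 0" using d by auto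
    then show "y powr \<nu> * exp (- y) * exp (- z * y powr (-1/2)) = h y * exp (- y)"
      using d zc[of "y / d"] by (simp add: h_def E powr_divide not_le)
  qed simp
  moreover have "integral {0..d} (\<lambda>t. h t * t ^ r) = d powr (\<nu> + 1) * d ^ r * integral {0..1} (E (\<nu> + r + 1))" for r
  proof -
    have "(E (\<nu> + r + 1) has_integral integral {0..1} (E (\<nu> + r + 1))) {0..1}"
      by (intro integrable_integral integrable_continuous_interval Econt)
    from has_integral_stretch_real[OF this, of "1 / d"] d
    have "((\<lambda>y. E (\<nu> + r + 1) (y / d)) has_integral d * integral {0..1} (E (\<nu> + r + 1))) ((\<lambda>x. x * d) ` {0..1})"
      by simp
    moreover have "(\<lambda>x. x * d) ` {0..1} = {0..d}"
      using d by (simp add: mult.commute[of _ d] image_mult_atLeastAtMost)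
    ultimately have "((\<lambda>y. d powr \<nu> * d ^ r * E (\<nu> + r + 1) (y / d)) has_integral
        d powr \<nu> * d ^ r * (d * integral {0..1} (E (\<nu> + r + 1)))) {0..d}"
      by (intro has_integral_mult_right) simp
    \<comment> \<open>The power y^r = d^r (y/d)^r is absorbed into the kernel by shifting its
      parameter.\<close>
    moreover have "d powr \<nu> * d ^ r * E (\<nu> + r + 1) (y / d) = h y * y ^ r" for y
    proof (cases "y / d > 0")
      case True
      have "(y / d) powr (\<nu> + r) = (y / d) powr \<nu> * (y / d) ^ r"
        using powr_realpow[OF True] by (simp only: powr_add)
      with True d show ?thesis by (simp add: h_def E power_divide)
    qed (simp add: h_def E)
    ultimately show ?thesis
      using d by (simp add: integral_unique powr_add)
  qed
  ultimately have "(\<lambda>r. (-1) ^ r / fact r * (d powr (\<nu> + 1) * d ^ r * integral {0..1} (E (\<nu> + r + 1)))) sums I2 z d \<nu>"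
    using sums by simp
  from sums_of_real[OF sums_divide[OF this, of "d powr (1 + \<nu>)"], where 'a = complex]
  have "(\<lambda>r. complex_of_real ((- d) ^ r / fact r * integral {0..1} (E (\<nu> + r + 1)))) sums of_real (I2 z d \<nu> / d powr (1 + \<nu>))"
    using d by (simp add: power_minus[of d] add_ac mult_ac)
  moreover have "inc_gamma c (- of_real \<beta>) = of_real (integral {0..1} (E \<beta>))" for \<beta>
    using inc_gamma_of_real[OF c, of "- \<beta>"] by (simp add: E_def)
  ultimately show ?thesis
    unfolding c_def[symmetric] by (simp only: of_real_mult)
qed

theorem corollary4p4:
  fixes z d \<nu> :: real
  assumes "z > 0" and "d > 0" and "\<nu> \<ge> 0"
  shows "summable (\<lambda>r::nat. complex_of_real ((- d) ^ r / fact r) *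
      meijer_G 3 0 [of_real (\<nu> + real r + 2)] [of_real (\<nu> + real r + 1), 0, 1/2]
        (of_real (z\<^sup>2 / (4 * d)))) \<and>
    complex_of_real (I2 z d \<nu>) = complex_of_real (d powr (1 + \<nu>) / pi powr (1/2)) *
      (\<Sum>r::nat. complex_of_real ((- d) ^ r / fact r) *
        meijer_G 3 0 [of_real (\<nu> + real r + 2)] [of_real (\<nu> + real r + 1), 0, 1/2]
          (of_real (z\<^sup>2 / (4 * d))))"
proof -
  let ?c = "z / sqrt d"
  have c: "?c > 0" using assms by simp
  have x: "z\<^sup>2 / (4 * d) = ?c\<^sup>2 / 4" using assms by (simp add: power_divide)
  have G: "meijer_G 3 0 [of_real (\<nu> + real r + 2)] [of_real (\<nu> + real r + 1), 0, 1/2] (of_real (z\<^sup>2 / (4 * d))) =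
      of_real (sqrt pi) * inc_gamma ?c (- of_real (\<nu> + real r + 1))" for r
  proof -
    have "complex_of_real (\<nu> + real r + 2) = of_real (\<nu> + real r + 1) + 1" by simp
    then show ?thesis
      unfolding x using meijer_G_value[OF c, of "\<nu> + real r + 1"] assms(3) by (simp only:)
  qed
  \<comment> \<open>The common factor sqrt pi of the G-values is what pi powr (1/2) in the prefactor
    removes.\<close>
  have "(\<lambda>r. complex_of_real ((- d) ^ r / fact r) *
        meijer_G 3 0 [of_real (\<nu> + real r + 2)] [of_real (\<nu> + real r + 1), 0, 1/2]
          (of_real (z\<^sup>2 / (4 * d)))) sums (of_real (sqrt pi) * of_real (I2 z d \<nu> / d powr (1 + \<nu>)))"
    unfolding G using sums_mult[OF I2_sums[OF assms], of "of_real (sqrt pi)"]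
    by (simp only: mult.left_commute)
  then show ?thesis
    using assms by (auto simp: sums_iff powr_half_sqrt)
qed

end
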